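(* Consider the general coding structure (described in the context) over horizon $\{0,\dots,T\}$. Fix any $0\le n\le T$. Then: (i) $$P_{T,n}(\mathcal R)=\inf_{\substack{A,C,\ \mathcal G_T:=\mathcal G_T^*(A,C)\\ R_T(A,C)\ge\mathcal R}}\ \frac1{T+1}\mathbf E\,(u^T)'u^T,$$ where $\mathcal G_T^*(A,C)$ is the optimal feedback generator for a given $(A,C)$, defined as $$\mathcal G_T^*(A,C):=\arg\inf_{(A,C)\text{ fixed},\ \mathcal G_T}\frac1{T+1}\mathbf E\,(u^T)'u^T .$$ (ii) The optimal feedback generator is given by $$\mathcal G_T^*(A,C)=-\widehat{\mathcal G}_T^*(A,C)\big(I-\mathcal Z_T^{-1}\widehat{\mathcal G}_T^*(A,C)\big)^{-1},$$ where $\widehat{\mathcal G}_T^*(A,C)$ is the strictly causal MMSE estimator (Kalman filter) of $r^T$ given the noisy observation $\bar y^T:=\mathcal Z_T^{-1}r^T+N^T$, i.e. $$\widehat{\mathcal G}_T^*(A,C):=\arg\inf_{\widehat{\mathcal G}_T}\ \frac1{T+1}\mathbf E\,(r^T-\widehat{\mathcal G}_T\bar y^T)'(r^T-\widehat{\mathcal G}_T\bar y^T),$$ the infimum being over strictly lower triangular $\widehat{\mathcal G}_T\in\mathbb R^{(T+1)\times(T+1)}$.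
   Context: Conventions. $'$ denotes transpose, $x^T$ denotes the stacked column vector of $x_0,\dots,x_T$, $\log$ is to base 2. Channel. $\mathcal Z(z)$ is a single-input single-output finite-dimensional LTI transfer function, stable and minimum phase, with $\mathcal Z(\infty)=1$. $\mathcal Z_T$ is the $(T+1)\times(T+1)$ lower-triangular Toeplitz matrix of its impulse response (unit diagonal). $\mathcal Z^{-1}$ has minimal realization $(F,G,H,1)$ with $F\in\mathbb R^{m\times m}$ stable, $m\ge1$. $\{N_t\}$ is white Gaussian noise, zero mean, unit variance. The channel $\mathcal F$ is $s_{t+1}=Fs_t+Gu_t$, $y_t=Hs_t+u_t+N_t$, $s_0=0$, i.e. $y^T=\mathcal Z_T^{-1}u^T+N^T$. General coding structure. $W\sim\mathcal N(0,I_{n+1})$ independent of $N^T$; encoder: $x_0=W$, $x_{t+1}=Ax_t$, $r_t=Cx_t$, $u_t=r_t-\hat r_t$, with $A\in\mathbb R^{(n+1)\times(n+1)}$, $C\in\mathbb R^{1\times(n+1)}$, $(A,C)$ observable, and no eigenvalue of $A$ on the unit circle or equal to an eigenvalue of $F$. Feedback generator: $-\hat r^T=\mathcal G_Ty^T$ with $\mathcal G_T\in\mathbb R^{(T+1)\times(T+1)}$ strictly lower triangular. The information rate $R_T(A,C):=\frac{1}{T+1}I(W;y^T)$ depends only on $(A,C)$ and not on $\mathcal G_T$. Let $C_{T,n}(\mathcal P):=\sup_{A,C,\mathcal G_T}\frac1{T+1}I(W;y^T)$ subject to $\frac1{T+1}\mathbf E(u^T)'u^T\le\mathcal P$, over all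 admissible $(A,C,\mathcal G_T)$ with $A$ of size $n+1$. $P_{T,n}(\mathcal R)$ is its inverse function, i.e. the infimum of $\frac1{T+1}\mathbf E(u^T)'u^T$ over all admissible $(A,C,\mathcal G_T)$ with $R_T(A,C)\ge\mathcal R$. *)

theory Defs
  imports
    "HOL-Probability.Probability"
    "HOL-Computational_Algebra.Polynomial_FPS"
    "Jordan_Normal_Form.Char_Poly"
    "Jordan_Normal_Form.Gauss_Jordan_Elimination"
begin

abbreviation complex_mat :: "real mat \<Rightarrow> complex mat" where
  "complex_mat \<equiv> map_mat complex_of_real"

text \<open>For square matrices this is the usual inverse; it is only meaningful for invertible ones.\<close>

definition mat_inv :: "'a::field mat \<Rightarrow> 'a mat" where
  "mat_inv X = the (mat_inverse X)"

section \<open>The channel\<close>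

text \<open>A real rational transfer function is given by its numerator and denominator.\<close>

definition transfer_fun :: "real poly \<Rightarrow> real poly \<Rightarrow> complex \<Rightarrow> complex" where
  "transfer_fun num den z =
     poly (map_poly complex_of_real num) z / poly (map_poly complex_of_real den) z"

text \<open>Discrete time: poles (stability) and zeros (minimum phase) lie in the open unit disc.\<close>

definition stable_minimum_phase :: "real poly \<Rightarrow> real poly \<Rightarrow> bool" where
  "stable_minimum_phase num den \<longleftrightarrow>
     coprime num den \<and>
     (\<forall>z. poly (map_poly complex_of_real den) z = 0 \<longrightarrow> cmod z < 1) \<and>
     (\<forall>z. poly (map_poly complex_of_real num) z = 0 \<longrightarrow> cmod z < 1)"

definition stable_mat :: "real mat \<Rightarrow> bool" where
  "stable_mat F \<longleftrightarrow> (\<forall>z. eigenvalue (complex_mat F) z \<longrightarrow> cmod z < 1)"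

definition realization ::
  "(complex \<Rightarrow> complex) \<Rightarrow> nat \<Rightarrow> real mat \<Rightarrow> real mat \<Rightarrow> real mat \<Rightarrow> real \<Rightarrow> bool" where
  "realization f m F G H D \<longleftrightarrow>
     F \<in> carrier_mat m m \<and> G \<in> carrier_mat m 1 \<and> H \<in> carrier_mat 1 m \<and>
     (\<forall>z. \<not> eigenvalue (complex_mat F) z \<longrightarrow>
        f z = (complex_mat H * mat_inv (z \<cdot>\<^sub>m 1\<^sub>m m - complex_mat F) * complex_mat G) $$ (0, 0)
              + complex_of_real D)"

definition minimal_realization ::
  "(complex \<Rightarrow> complex) \<Rightarrow> nat \<Rightarrow> real mat \<Rightarrow> real mat \<Rightarrow> real mat \<Rightarrow> real \<Rightarrow> bool" where
  "minimal_realization f m F G H D \<longleftrightarrow>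
     realization f m F G H D \<and>
     (\<forall>m' F' G' H' D'. realization f m' F' G' H' D' \<longrightarrow> m \<le> m')"

text \<open>
  The impulse response consists of the coefficients of the expansion of the transfer function in
  powers of \<open>1/z\<close>. Here numerator and denominator have the same degree \<open>d\<close> (the value at infinity
  is 1), and \<open>w ^ d * p (1/w)\<close> is the value at \<open>w\<close> of the reflected polynomial of \<open>p\<close>.
\<close>

definition impulse_response :: "real poly \<Rightarrow> real poly \<Rightarrow> nat \<Rightarrow> real" where
  "impulse_response num den =
     fps_nth (fps_of_poly (reflect_poly num) / fps_of_poly (reflect_poly den))"

definition toeplitz :: "nat \<Rightarrow> (nat \<Rightarrow> real) \<Rightarrow> real mat" where
  "toeplitz T h = Matrix.mat (T + 1) (T + 1) (\<lambda>(i, j). if j \<le> i then h (i - j) else 0)"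

definition channel_mat :: "nat \<Rightarrow> real poly \<Rightarrow> real poly \<Rightarrow> real mat" where
  "channel_mat T num den = toeplitz T (impulse_response num den)"

section \<open>The coding structure\<close>

definition strictly_lower :: "nat \<Rightarrow> real mat \<Rightarrow> bool" where
  "strictly_lower T L \<longleftrightarrow>
     L \<in> carrier_mat (T + 1) (T + 1) \<and> (\<forall>i\<le>T. \<forall>j\<le>T. i \<le> j \<longrightarrow> L $$ (i, j) = 0)"

primrec encoder_state :: "real mat \<Rightarrow> real vec \<Rightarrow> nat \<Rightarrow> real vec" where
  "encoder_state A w 0 = w"
| "encoder_state A w (Suc t) = A *\<^sub>v encoder_state A w t"

definition encoder_output :: "real mat \<Rightarrow> real mat \<Rightarrow> real vec \<Rightarrow> nat \<Rightarrow> real" where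
  "encoder_output A C w t = vec_index (C *\<^sub>v encoder_state A w t) 0"

text \<open>Observability: different initial states give different output sequences.\<close>

definition observable :: "nat \<Rightarrow> real mat \<Rightarrow> real mat \<Rightarrow> bool" where
  "observable d A C \<longleftrightarrow>
     (\<forall>x\<in>carrier_vec d. \<forall>x'\<in>carrier_vec d.
        (\<forall>t. encoder_output A C x t = encoder_output A C x' t) \<longrightarrow> x = x')"

definition admissible :: "real mat \<Rightarrow> nat \<Rightarrow> real mat \<Rightarrow> real mat \<Rightarrow> bool" where
  "admissible F n A C \<longleftrightarrow>
     A \<in> carrier_mat (n + 1) (n + 1) \<and> C \<in> carrier_mat 1 (n + 1) \<and> observable (n + 1) A C \<and>
     (\<forall>z. eigenvalue (complex_mat A) z \<longrightarrow>
        cmod z \<noteq> 1 \<and> \<not> eigenvalue (complex_mat F) z)"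

text \<open>
  Closed-loop signals for a given source sequence \<open>r\<close>, noise sequence \<open>v\<close> and feedback generator
  \<open>L\<close>. As \<open>L\<close> is strictly lower triangular, row \<open>t\<close> of \<open>L\<close> times the output sequence only involves
  the outputs at times \<open>k < t\<close>; this is minus the feedback signal.
\<close>

function (sequential)
  channel_state ::
    "real mat \<Rightarrow> real mat \<Rightarrow> real mat \<Rightarrow> real mat \<Rightarrow> (nat \<Rightarrow> real) \<Rightarrow> (nat \<Rightarrow> real) \<Rightarrow> nat \<Rightarrow> real vec" and
  channel_input ::
    "real mat \<Rightarrow> real mat \<Rightarrow> real mat \<Rightarrow> real mat \<Rightarrow> (nat \<Rightarrow> real) \<Rightarrow> (nat \<Rightarrow> real) \<Rightarrow> nat \<Rightarrow> real" and
  channel_output ::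
    "real mat \<Rightarrow> real mat \<Rightarrow> real mat \<Rightarrow> real mat \<Rightarrow> (nat \<Rightarrow> real) \<Rightarrow> (nat \<Rightarrow> real) \<Rightarrow> nat \<Rightarrow> real"
where
  "channel_state F G H L r v 0 = 0\<^sub>v (dim_row F)"
| "channel_state F G H L r v (Suc t) =
     F *\<^sub>v channel_state F G H L r v t + channel_input F G H L r v t \<cdot>\<^sub>v col G 0"
| "channel_input F G H L r v t = r t + (\<Sum>k<t. L $$ (t, k) * channel_output F G H L r v k)"
| "channel_output F G H L r v t =
     vec_index (H *\<^sub>v channel_state F G H L r v t) 0 + channel_input F G H L r v t + v t"
  by pat_completeness auto
termination
  by (relation "Wellfounded.measure (case_sum (\<lambda>(F, G, H, L, r, v, t). 3 * t)
        (case_sum (\<lambda>(F, G, H, L, r, v, t). 3 * t + 1) (\<lambda>(F, G, H, L, r, v, t). 3 * t + 2)))")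
     auto

section \<open>Random signals\<close>

definition white_gaussian_noise :: "'a measure \<Rightarrow> (nat \<Rightarrow> 'a \<Rightarrow> real) \<Rightarrow> bool" where
  "white_gaussian_noise M N \<longleftrightarrow>
     prob_space.indep_vars M (\<lambda>_. borel) N UNIV \<and>
     (\<forall>t. distributed M lborel (N t) std_normal_density)"

text \<open>The message is the vector with components \<open>W 0, \<dots>, W n\<close>.\<close>

definition standard_gaussian_message :: "'a measure \<Rightarrow> nat \<Rightarrow> (nat \<Rightarrow> 'a \<Rightarrow> real) \<Rightarrow> bool" where
  "standard_gaussian_message M n W \<longleftrightarrow>
     prob_space.indep_vars M (\<lambda>_. borel) W {..n} \<and>
     (\<forall>i\<le>n. distributed M lborel (W i) std_normal_density)"

abbreviation real_space :: "nat \<Rightarrow> (nat \<Rightarrow> real) measure" where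
  "real_space k \<equiv> PiM {..k} (\<lambda>_. borel)"

definition block :: "nat \<Rightarrow> (nat \<Rightarrow> 'a \<Rightarrow> real) \<Rightarrow> 'a \<Rightarrow> nat \<Rightarrow> real" where
  "block k X \<omega> = (\<lambda>i\<in>{..k}. X i \<omega>)"

definition source_signal ::
  "nat \<Rightarrow> (nat \<Rightarrow> 'a \<Rightarrow> real) \<Rightarrow> real mat \<Rightarrow> real mat \<Rightarrow> nat \<Rightarrow> 'a \<Rightarrow> real" where
  "source_signal n W A C t \<omega> = encoder_output A C (Matrix.vec (n + 1) (\<lambda>i. W i \<omega>)) t"

definition input_signal ::
  "real mat \<Rightarrow> real mat \<Rightarrow> real mat \<Rightarrow> nat \<Rightarrow> (nat \<Rightarrow> 'a \<Rightarrow> real) \<Rightarrow> (nat \<Rightarrow> 'a \<Rightarrow> real) \<Rightarrow>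
   real mat \<Rightarrow> real mat \<Rightarrow> real mat \<Rightarrow> nat \<Rightarrow> 'a \<Rightarrow> real" where
  "input_signal F G H n W N A C L t \<omega> =
     channel_input F G H L (\<lambda>k. source_signal n W A C k \<omega>) (\<lambda>k. N k \<omega>) t"

definition output_signal ::
  "real mat \<Rightarrow> real mat \<Rightarrow> real mat \<Rightarrow> nat \<Rightarrow> (nat \<Rightarrow> 'a \<Rightarrow> real) \<Rightarrow> (nat \<Rightarrow> 'a \<Rightarrow> real) \<Rightarrow>
   real mat \<Rightarrow> real mat \<Rightarrow> real mat \<Rightarrow> nat \<Rightarrow> 'a \<Rightarrow> real" where
  "output_signal F G H n W N A C L t \<omega> =
     channel_output F G H L (\<lambda>k. source_signal n W A C k \<omega>) (\<lambda>k. N k \<omega>) t"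

definition average_power ::
  "'a measure \<Rightarrow> real mat \<Rightarrow> real mat \<Rightarrow> real mat \<Rightarrow> nat \<Rightarrow> nat \<Rightarrow>
   (nat \<Rightarrow> 'a \<Rightarrow> real) \<Rightarrow> (nat \<Rightarrow> 'a \<Rightarrow> real) \<Rightarrow> real mat \<Rightarrow> real mat \<Rightarrow> real mat \<Rightarrow> real" where
  "average_power M F G H T n W N A C L =
     1 / real (T + 1) *
     prob_space.expectation M (\<lambda>\<omega>. \<Sum>t\<le>T. (input_signal F G H n W N A C L t \<omega>)\<^sup>2)"

text \<open>
  The rate does not depend on the feedback generator \<open>L\<close>, but this is a property of the system and
  not part of the definition: the channel output is the one obtained with \<open>L\<close>.
\<close>

definition information_rate ::
  "'a measure \<Rightarrow> real mat \<Rightarrow> real mat \<Rightarrow> real mat \<Rightarrow> nat \<Rightarrow> nat \<Rightarrow>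
   (nat \<Rightarrow> 'a \<Rightarrow> real) \<Rightarrow> (nat \<Rightarrow> 'a \<Rightarrow> real) \<Rightarrow> real mat \<Rightarrow> real mat \<Rightarrow> real mat \<Rightarrow> real" where
  "information_rate M F G H T n W N A C L =
     1 / real (T + 1) *
     prob_space.mutual_information M 2 (real_space n) (real_space T)
       (block n W) (block T (output_signal F G H n W N A C L))"

text \<open>Infima are taken in the extended reals, so that an empty infimum is \<open>\<infinity>\<close>.\<close>

definition min_power ::
  "'a measure \<Rightarrow> real mat \<Rightarrow> real mat \<Rightarrow> real mat \<Rightarrow> nat \<Rightarrow> nat \<Rightarrow>
   (nat \<Rightarrow> 'a \<Rightarrow> real) \<Rightarrow> (nat \<Rightarrow> 'a \<Rightarrow> real) \<Rightarrow> real \<Rightarrow> ereal" where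
  "min_power M F G H T n W N R =
     (INF (A, C, L) \<in> {(A, C, L). admissible F n A C \<and> strictly_lower T L \<and>
                          R \<le> information_rate M F G H T n W N A C L}.
        ereal (average_power M F G H T n W N A C L))"

section \<open>Optimal feedback generator and optimal estimator\<close>

definition optimal_feedback ::
  "'a measure \<Rightarrow> real mat \<Rightarrow> real mat \<Rightarrow> real mat \<Rightarrow> nat \<Rightarrow> nat \<Rightarrow>
   (nat \<Rightarrow> 'a \<Rightarrow> real) \<Rightarrow> (nat \<Rightarrow> 'a \<Rightarrow> real) \<Rightarrow> real mat \<Rightarrow> real mat \<Rightarrow> real mat" where
  "optimal_feedback M F G H T n W N A C =
     arg_min (average_power M F G H T n W N A C) (strictly_lower T)"

definition source_block ::
  "nat \<Rightarrow> nat \<Rightarrow> (nat \<Rightarrow> 'a \<Rightarrow> real) \<Rightarrow> real mat \<Rightarrow> real mat \<Rightarrow> 'a \<Rightarrow> real vec" where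
  "source_block T n W A C \<omega> = Matrix.vec (T + 1) (\<lambda>t. source_signal n W A C t \<omega>)"

definition observation_block ::
  "real poly \<Rightarrow> real poly \<Rightarrow> nat \<Rightarrow> nat \<Rightarrow> (nat \<Rightarrow> 'a \<Rightarrow> real) \<Rightarrow> (nat \<Rightarrow> 'a \<Rightarrow> real) \<Rightarrow>
   real mat \<Rightarrow> real mat \<Rightarrow> 'a \<Rightarrow> real vec" where
  "observation_block num den T n W N A C \<omega> =
     mat_inv (channel_mat T num den) *\<^sub>v source_block T n W A C \<omega>
     + Matrix.vec (T + 1) (\<lambda>t. N t \<omega>)"

definition estimation_error ::
  "'a measure \<Rightarrow> real poly \<Rightarrow> real poly \<Rightarrow> nat \<Rightarrow> nat \<Rightarrow>
   (nat \<Rightarrow> 'a \<Rightarrow> real) \<Rightarrow> (nat \<Rightarrow> 'a \<Rightarrow> real) \<Rightarrow> real mat \<Rightarrow> real mat \<Rightarrow> real mat \<Rightarrow> real" where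
  "estimation_error M num den T n W N A C K =
     1 / real (T + 1) *
     prob_space.expectation M (\<lambda>\<omega>.
       let e = source_block T n W A C \<omega> - K *\<^sub>v observation_block num den T n W N A C \<omega>
       in scalar_prod e e)"

definition optimal_estimator ::
  "'a measure \<Rightarrow> real poly \<Rightarrow> real poly \<Rightarrow> nat \<Rightarrow> nat \<Rightarrow>
   (nat \<Rightarrow> 'a \<Rightarrow> real) \<Rightarrow> (nat \<Rightarrow> 'a \<Rightarrow> real) \<Rightarrow> real mat \<Rightarrow> real mat \<Rightarrow> real mat" where
  "optimal_estimator M num den T n W N A C =
     arg_min (estimation_error M num den T n W N A C) (strictly_lower T)"

end

(*
Let P be the inverse of the channel matrix, i.e. the Toeplitz matrix of the Markov parameters of
(F, G, H, 1). Closing the loop with a strictly lower triangular L gives y = P u + v, u = r + L y,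
hence u = r - K ybar with ybar = P r + v and K = - L (I - P L)^-1. So the power of L is the estimation error of K,
and L -> K is an involution on the strictly lower triangular matrices, which carries the unique
minimiser of one problem to that of the other. The estimation problem has a unique minimiser because
the white noise makes the quadratic form E (sum_j k_j ybar_j)^2 at least sum_j k_j^2, so that the
normal equations of each row are solvable. Finally y is an invertible linear function of ybar,
so the rate does not depend on L, and in (i) each L may be replaced by the optimal one.
*)

theory Submission
  imports Defs
begin

section \<open>Triangular matrices\<close>

text \<open>The two descriptions of the channel meet at a single point: the channel matrix is built
  from formal power series of reflected polynomials, whereas \<open>F\<close>, \<open>G\<close>,
  \<open>H\<close> represent the reciprocal transfer function as a function of a complex argument.
  Equality of coefficients is therefore drawn from asymptotics at infinity: finitely many uses of
  the resolvent identity give an expansion in 1/z with an explicit bound on the remainder. Both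
  optimisers are Hilbert choices, so the formula in (ii) rests on uniqueness of the minimisers. For
  this reason optimality is proved in a sharpened form, in which a competitor loses at least its
  squared distance from the minimiser. Mutual information is a divergence of measures that takes a
  default value when no density exists. Its invariance is proved at that level, for any measurable
  change of the output with a measurable left inverse, so that no Gaussian density or determinant is
  ever computed.\<close>

lemma mat_inv_eqI:
  fixes X :: "'a::field mat"
  assumes X: "X \<in> carrier_mat n n" and Y: "Y \<in> carrier_mat n n" and XY: "X * Y = 1\<^sub>m n"
  shows "mat_inv X = Y"
proof -
  have YX: "Y * X = 1\<^sub>m n"
    by (rule mat_mult_left_right_inverse[OF X Y XY])
  \<comment> \<open>\<open>mat_inverse\<close> is specified through the units of the matrix ring:
    the answer \<open>None\<close> would mean that \<open>X\<close> is not a unit. The argument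
    \<open>b\<close> is a dummy of that ring.\<close>
  have "X \<in> Units (ring_mat TYPE('a) n b)" for b :: unit
    using X Y XY YX by (auto simp: Units_def ring_mat_def)
  then obtain B where B: "mat_inverse X = Some B"
    using mat_inverse(1)[OF X] by fastforce
  from mat_inverse(2)[OF X B] have *: "X * B = 1\<^sub>m n" "B \<in> carrier_mat n n"
    by auto
  have "B = (Y * X) * B"
    using YX * by simp
  also have "\<dots> = Y * (X * B)"
    using X Y * by (simp add: assoc_mult_mat)
  also have "\<dots> = Y"
    using * Y by simp
  finally show ?thesis
    by (simp add: mat_inv_def B)
qed

lemma mat_inv_right:
  fixes X :: "'a::field mat"
  assumes X: "X \<in> carrier_mat n n" and "det X \<noteq> 0"
  shows "mat_inv X \<in> carrier_mat n n" and "X * mat_inv X = 1\<^sub>m n"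
    and "mat_inv X * X = 1\<^sub>m n"
proof -
  have "X \<in> Units (ring_mat TYPE('a) n ())"
    by (rule det_non_zero_imp_unit[OF assms])
  then obtain B where B: "mat_inverse X = Some B"
    using mat_inverse(1)[OF X] by fastforce
  from mat_inverse(2)[OF X B]
  show "mat_inv X \<in> carrier_mat n n" "X * mat_inv X = 1\<^sub>m n" "mat_inv X * X = 1\<^sub>m n"
    by (auto simp: mat_inv_def B)
qed

section \<open>Entrywise products and inverses of triangular matrices\<close>

lemma index_mult_mat_sum:
  assumes "X \<in> carrier_mat k l" "Y \<in> carrier_mat l j" "a < k" "b < j"
  shows "(X * Y) $$ (a, b) = (\<Sum>c<l. X $$ (a, c) * Y $$ (c, b))"
  using assms by (auto simp: scalar_prod_def atLeast0LessThan intro!: sum.cong)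

lemma index_mult_mat_vec_sum:
  assumes "X \<in> carrier_mat k l" "v \<in> carrier_vec l" "a < k"
  shows "vec_index (X *\<^sub>v v) a = (\<Sum>c<l. X $$ (a, c) * vec_index v c)"
  using assms by (auto simp: scalar_prod_def atLeast0LessThan intro!: sum.cong)

definition lower_triangular :: "nat \<Rightarrow> real mat \<Rightarrow> bool" where
  "lower_triangular T P \<longleftrightarrow>
     P \<in> carrier_mat (T + 1) (T + 1) \<and> (\<forall>i\<le>T. \<forall>j\<le>T. i < j \<longrightarrow> P $$ (i, j) = 0)"

lemma strictly_lower_mult_right:
  assumes P: "strictly_lower T X" and L: "lower_triangular T Y"
  shows "strictly_lower T (X * Y)"
  unfolding strictly_lower_def
proof (intro conjI allI impI)
  show c: "X * Y \<in> carrier_mat (T + 1) (T + 1)"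
    using assms by (auto simp: lower_triangular_def strictly_lower_def)
  fix i j assume ij: "i \<le> T" "j \<le> T" "i \<le> j"
  have "(X * Y) $$ (i, j) = (\<Sum>k<T + 1. X $$ (i, k) * Y $$ (k, j))"
    using assms ij by (intro index_mult_mat_sum) (auto simp: lower_triangular_def strictly_lower_def)
  also have "\<dots> = 0"
  proof (intro sum.neutral ballI)
    fix k assume "k \<in> {..<T + 1}"
    then show "X $$ (i, k) * Y $$ (k, j) = 0"
      using assms ij by (cases "i \<le> k") (auto simp: lower_triangular_def strictly_lower_def)
  qed
  finally show "(X * Y) $$ (i, j) = 0" .
qed

lemma strictly_lower_mult_left:
  assumes P: "lower_triangular T X" and L: "strictly_lower T Y"
  shows "strictly_lower T (X * Y)"
  unfolding strictly_lower_def
proof (intro conjI allI impI)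
  show c: "X * Y \<in> carrier_mat (T + 1) (T + 1)"
    using assms by (auto simp: lower_triangular_def strictly_lower_def)
  fix i j assume ij: "i \<le> T" "j \<le> T" "i \<le> j"
  have "(X * Y) $$ (i, j) = (\<Sum>k<T + 1. X $$ (i, k) * Y $$ (k, j))"
    using assms ij by (intro index_mult_mat_sum) (auto simp: lower_triangular_def strictly_lower_def)
  also have "\<dots> = 0"
  proof (intro sum.neutral ballI)
    fix k assume "k \<in> {..<T + 1}"
    then show "X $$ (i, k) * Y $$ (k, j) = 0"
      using assms ij by (cases "i < k") (auto simp: lower_triangular_def strictly_lower_def)
  qed
  finally show "(X * Y) $$ (i, j) = 0" .
qed

text \<open>The matrix is lower triangular with unit diagonal, so its determinant is 1. That the
  inverse is triangular again is read off the fixed-point equation B = 1 + X B.\<close>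

lemma inverse_one_minus_strictly_lower:
  assumes X: "strictly_lower T X"
  defines "B \<equiv> mat_inv (1\<^sub>m (T + 1) - X)"
  shows "lower_triangular T B"
    and "(1\<^sub>m (T + 1) - X) * B = 1\<^sub>m (T + 1)" and "B * (1\<^sub>m (T + 1) - X) = 1\<^sub>m (T + 1)"
proof -
  have Xc: "X \<in> carrier_mat (T + 1) (T + 1)"
    using X by (simp add: strictly_lower_def)
  define Y where "Y = 1\<^sub>m (T + 1) - X"
  have Yc: "Y \<in> carrier_mat (T + 1) (T + 1)"
    using Xc by (simp add: Y_def minus_carrier_mat)
  have "det Y = prod_list (diag_mat Y)"
    using X by (intro det_lower_triangular[OF _ Yc]) (auto simp: Y_def strictly_lower_def)
  also have "diag_mat Y = map (\<lambda>_. 1) [0..<T + 1]"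
    using X by (auto simp: diag_mat_def Y_def strictly_lower_def)
  also have "prod_list (map (\<lambda>_. 1) [0..<T + 1]) = (1::real)"
    by (simp only: map_replicate_const prod_list_replicate power_one)
  finally have "det Y \<noteq> 0"
    by simp
  from mat_inv_right[OF Yc this]
  have Bc: "B \<in> carrier_mat (T + 1) (T + 1)" and YB: "Y * B = 1\<^sub>m (T + 1)"
    and BY: "B * Y = 1\<^sub>m (T + 1)"
    by (simp_all add: B_def Y_def)
  from YB BY show "(1\<^sub>m (T + 1) - X) * B = 1\<^sub>m (T + 1)" "B * (1\<^sub>m (T + 1) - X) = 1\<^sub>m (T + 1)"
    by (simp_all add: Y_def)
  \<comment> \<open>Since \<open>X\<close> is strictly lower triangular, this expresses row
    \<open>i\<close> of \<open>B\<close> by the rows above it, which permits induction on the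
    row.\<close>
  have rec: "B $$ (i, j) = (if i = j then 1 else 0) + (\<Sum>k<T + 1. X $$ (i, k) * B $$ (k, j))"
    if "i \<le> T" "j \<le> T" for i j
  proof -
    have "Y * B = B - X * B"
      unfolding Y_def using Bc Xc by (subst minus_mult_distrib_mat) auto
    then have "(B - X * B) $$ (i, j) = 1\<^sub>m (T + 1) $$ (i, j)"
      using YB by simp
    then show ?thesis
      using that Bc Xc index_mult_mat_sum[OF Xc Bc, of i j] by auto
  qed
  have "B $$ (i, j) = 0" if "i \<le> T" "j \<le> T" "i < j" for i j
    using that
  proof (induction i rule: less_induct)
    case (less i)
    have "(\<Sum>k<T + 1. X $$ (i, k) * B $$ (k, j)) = 0"
    proof (intro sum.neutral ballI)
      fix k assume "k \<in> {..<T + 1}"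
      then show "X $$ (i, k) * B $$ (k, j) = 0"
        using X less by (cases "k < i") (auto simp: strictly_lower_def)
    qed
    then show ?case
      using rec[of i j] less.prems by simp
  qed
  then show "lower_triangular T B"
    using Bc by (auto simp: lower_triangular_def)
qed

text \<open>
  With \<open>P\<close> the channel response, closing the loop with the feedback generator \<open>L\<close> amounts to
  running the estimator \<open>feedback_dual T P L\<close> on the open-loop output.
\<close>

definition feedback_dual :: "nat \<Rightarrow> real mat \<Rightarrow> real mat \<Rightarrow> real mat" where
  "feedback_dual T P L = - L * mat_inv (1\<^sub>m (T + 1) - P * L)"

lemma strictly_lower_uminus: "strictly_lower T X \<Longrightarrow> strictly_lower T (- X)"
  by (auto simp: strictly_lower_def)

lemma strictly_lower_feedback_dual:
  assumes "lower_triangular T P" "strictly_lower T L"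
  shows "strictly_lower T (feedback_dual T P L)"
  unfolding feedback_dual_def using assms
  by (intro strictly_lower_mult_right strictly_lower_uminus inverse_one_minus_strictly_lower
      strictly_lower_mult_left)

text \<open>With B the inverse of 1 - P L and K = - L B, the equation B - P L B = 1 says that 1 - P
  K = B. So the inverse needed for the second application is 1 - P L itself, and - K (1 - P L) = L B
  (1 - P L) = L.\<close>

lemma feedback_dual_involution:
  assumes P: "lower_triangular T P" and L: "strictly_lower T L"
  shows "feedback_dual T P (feedback_dual T P L) = L"
proof -
  define n where "n = T + 1"
  define Y where "Y = 1\<^sub>m n - P * L"
  define B where "B = mat_inv Y"
  define K where "K = feedback_dual T P L"
  have [simp]: "P \<in> carrier_mat n n" "L \<in> carrier_mat n n"
    using assms by (auto simp: lower_triangular_def strictly_lower_def n_def)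
  then have [simp]: "Y \<in> carrier_mat n n"
    by (simp add: Y_def minus_carrier_mat mult_carrier_mat[of _ n n])
  note inv = inverse_one_minus_strictly_lower[OF strictly_lower_mult_left[OF P L], folded n_def, folded Y_def, folded B_def]
  have [simp]: "B \<in> carrier_mat n n"
    using inv(1) by (auto simp: lower_triangular_def n_def)
  have K: "K = - L * B"
    by (simp add: K_def feedback_dual_def B_def Y_def n_def)
  have [simp]: "P * L \<in> carrier_mat n n" "P * L * B \<in> carrier_mat n n"
    by (simp_all add: mult_carrier_mat[of _ n n])
  have "Y * B = 1\<^sub>m n * B - P * L * B"
    unfolding Y_def by (rule minus_mult_distrib_mat[of _ n n _ _ n]) simp_all
  then have e: "B - P * L * B = 1\<^sub>m n"
    using inv(2) left_mult_one_mat[of B n n] by simp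
  have PK': "P * K = - (P * L * B)"
    unfolding K using carrier_matD[of L n n] carrier_matD[of P n n] carrier_matD[of B n n]
    by (simp add: assoc_mult_mat[of _ n n _ n _ n])
  have PK: "1\<^sub>m n - P * K = B"
    unfolding PK' using arg_cong[OF e, of "\<lambda>X. X $$ (i, j)" for i j]
      carrier_matD[of "P * L * B" n n] carrier_matD[of B n n]
    by (intro eq_matI) (auto simp flip: e)
  have "feedback_dual T P K = - K * mat_inv B"
    unfolding feedback_dual_def using PK by (simp add: n_def)
  also have "mat_inv B = Y"
    by (rule mat_inv_eqI[OF _ _ inv(3)]) auto
  also have "- K * Y = L * (B * Y)"
    unfolding K using carrier_matD[of L n n] carrier_matD[of Y n n] carrier_matD[of B n n]
    by (simp add: assoc_mult_mat[of _ n n _ n _ n])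
  also have "\<dots> = L"
    using inv(3) right_mult_one_mat[of L n n] by simp
  finally show ?thesis
    by (simp add: K_def)
qed

section \<open>Markov parameters and the inverse channel\<close>

text \<open>The coefficients of D + H (z - F)^-1 G in powers of 1/z, which are also the impulse
  response of the state recursion.\<close>

primrec markov_parameter :: "real mat \<Rightarrow> real mat \<Rightarrow> real mat \<Rightarrow> real \<Rightarrow> nat \<Rightarrow> real" where
  "markov_parameter F G H D 0 = D"
| "markov_parameter F G H D (Suc j) = (H * F ^\<^sub>m j * G) $$ (0, 0)"

text \<open>Converts an asymptotic estimate into equality of coefficients. Continuity at 0 kills the
  constant term; dividing by w, which is nonzero in the punctured filter, lowers the order by one
  with the same constant \<open>C\<close>.\<close>

lemma poly_coeff_eq_0_if_bigo:
  fixes p :: "complex poly"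
  assumes "\<forall>\<^sub>F w in at 0. norm (poly p w) \<le> C * norm w ^ Suc K" "i \<le> K"
  shows "coeff p i = 0"
proof -
  have coeff_0: "coeff q 0 = 0"
    if "\<forall>\<^sub>F w in at 0. norm (poly q w) \<le> C * norm w ^ Suc k" for q :: "complex poly" and k
  proof -
    have "((\<lambda>w. poly q w) \<longlongrightarrow> 0) (at 0)"
      by (rule Lim_null_comparison[OF that]) (auto intro!: tendsto_eq_intros)
    moreover have "((\<lambda>w. poly q w) \<longlongrightarrow> poly q 0) (at 0)"
      by (intro tendsto_intros)
    ultimately have "poly q 0 = 0"
      using tendsto_unique[OF at_neq_bot] by blast
    then show ?thesis
      by (simp add: poly_0_coeff_0)
  qed
  show ?thesis
    using assms
  proof (induction K arbitrary: p i)
    case (0 p i)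
    then show ?case
      using coeff_0[OF 0(1)] by simp
  next
    case (Suc K p i)
    have c0: "coeff p 0 = 0"
      by (rule coeff_0[OF Suc.prems(1)])
    obtain a q where pq: "p = pCons a q"
      by (cases p)
    with c0 have [simp]: "a = 0"
      by simp
    have "\<forall>\<^sub>F w in at (0::complex). w \<noteq> 0"
      by (simp add: eventually_at_filter)
    with Suc.prems(1) have "\<forall>\<^sub>F w in at 0. norm (poly q w) \<le> C * norm w ^ Suc K"
    proof eventually_elim
      case (elim w)
      have "norm w * norm (poly q w) \<le> norm w * (C * norm w ^ Suc K)"
        using elim(1) by (simp add: pq norm_mult mult_ac)
      then show ?case
        using elim(2) by (subst (asm) mult_le_cancel_left_pos) auto
    qed
    from Suc.IH[OF this] have "coeff q j = 0" if "j \<le> K" for j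
      using that by blast
    then show ?case
      using Suc.prems(2) by (cases i) (auto simp: pq)
  qed
qed

section \<open>Expansion of a realization at infinity\<close>

lemma invertible_resolvent:
  assumes F: "F \<in> carrier_mat m m" and ne: "\<not> eigenvalue F z"
  shows "det (z \<cdot>\<^sub>m 1\<^sub>m m - F) \<noteq> (0 :: 'a :: field)"
proof
  assume "det (z \<cdot>\<^sub>m 1\<^sub>m m - F) = 0"
  moreover have "z \<cdot>\<^sub>m 1\<^sub>m m - F \<in> carrier_mat m m"
    using F by (simp add: minus_carrier_mat)
  ultimately obtain v where v: "v \<in> carrier_vec m" "v \<noteq> 0\<^sub>v m"
    and e: "(z \<cdot>\<^sub>m 1\<^sub>m m - F) *\<^sub>v v = 0\<^sub>v m"
    using det_0_iff_vec_prod_zero_field by metis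
  have "(z \<cdot>\<^sub>m 1\<^sub>m m - F) *\<^sub>v v = (z \<cdot>\<^sub>m 1\<^sub>m m) *\<^sub>v v - F *\<^sub>v v"
    using F v by (intro minus_mult_distrib_mat_vec) auto
  also have "(z \<cdot>\<^sub>m 1\<^sub>m m) *\<^sub>v v = z \<cdot>\<^sub>v v"
    using v by (intro eq_vecI) (auto simp: row_smult smult_scalar_prod_distrib[of _ m])
  finally have "z \<cdot>\<^sub>v v - F *\<^sub>v v = 0\<^sub>v m"
    using e by simp
  then have "vec_index (z \<cdot>\<^sub>v v - F *\<^sub>v v) i = 0" if "i < m" for i
    using that by simp
  then have "F *\<^sub>v v = z \<cdot>\<^sub>v v"
    using F v by (intro eq_vecI) auto
  then have "eigenvalue F z"
    using F v unfolding eigenvalue_def eigenvector_def by auto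
  with ne show False by simp
qed

text \<open>For z = 1/w outside the unit disc, stability makes the resolvent available. The column a
  = (z - F)^-1 G satisfies z a = G + F a; each use of this equation splits off one Markov parameter
  and a factor w. After K uses the remainder is w^K H F^K a, and a itself is of order w.\<close>

lemma realization_expansion:
  assumes re: "realization f m F G H D" and st: "stable_mat F"
  shows "\<exists>C. \<forall>\<^sub>F w in at 0.
    norm (f (inverse w) - (\<Sum>k\<le>K. w ^ k * complex_of_real (markov_parameter F G H D k)))
      \<le> C * norm w ^ Suc K"
proof -
  \<comment> \<open>Keeps the dimension \<open>1\<close> from turning into \<open>Suc 0\<close>, so
    that the carrier facts continue to match.\<close>
  note One_nat_def [simp del]
  define F' where "F' = complex_mat F"
  define G' where "G' = complex_mat G"
  define H' where "H' = complex_mat H"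
  have [simp]: "F \<in> carrier_mat m m" "G \<in> carrier_mat m 1" "H \<in> carrier_mat 1 m"
    using re by (auto simp: realization_def)
  have [simp]: "F' \<in> carrier_mat m m" "G' \<in> carrier_mat m 1" "H' \<in> carrier_mat 1 m"
    by (auto simp: F'_def G'_def H'_def)
  have [simp]: "F' ^\<^sub>m j \<in> carrier_mat m m" "F ^\<^sub>m j \<in> carrier_mat m m" for j
    by (auto intro: pow_carrier_mat)
  have [simp]: "H' * F' ^\<^sub>m j \<in> carrier_mat 1 m" "H * F ^\<^sub>m j \<in> carrier_mat 1 m" for j
    by (simp_all add: mult_carrier_mat[of _ 1 m])
  \<comment> \<open>The column is left open because two are inserted: \<open>G'\<close> gives the
    Markov parameters, the resolvent applied to \<open>G'\<close> gives the remainder.\<close>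
  define q where "q j a = (H' * F' ^\<^sub>m j * a) $$ (0, 0)" for j a
  define p where "p j = complex_of_real (markov_parameter F G H D j)" for j
  have p_Suc: "p (Suc j) = q j G'" for j
  proof -
    have "q j G' = complex_mat (H * F ^\<^sub>m j * G) $$ (0, 0)"
      unfolding q_def F'_def G'_def H'_def
      by (simp add: of_real_hom.mat_hom_mult[of _ 1 m _ 1] of_real_hom.mat_hom_mult[of _ 1 m _ m]
          of_real_hom.mat_hom_pow[of _ m])
    also have "\<dots> = p (Suc j)"
      using carrier_matD[of H 1 m] carrier_matD[of G m 1]
      unfolding p_def by (subst index_map_mat) auto
    finally show ?thesis by simp
  qed
  define c where "c = (\<Sum>i<m. \<Sum>k<m. norm (F' $$ (i, k)))"
  define g where "g = (\<Sum>i<m. norm (G' $$ (i, 0)))"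
  define h where "h = (\<Sum>i<m. norm ((H' * F' ^\<^sub>m K) $$ (0, i)))"
  have h0: "h \<ge> 0"
    by (auto simp: h_def intro!: sum_nonneg)
  \<comment> \<open>The third condition on \<open>w\<close> makes the contribution of
    \<open>F'\<close> to the estimate of the resolvent column at most half of that column's size, so
    it can be absorbed on the left. This is the source of the factor 2 in the constant.\<close>
  have "norm (f (inverse w) - (\<Sum>k\<le>K. w ^ k * p k)) \<le> h * (2 * g) * norm w ^ Suc K"
    if w: "w \<noteq> 0" "norm w < 1" "norm w * (2 * c) \<le> 1" for w
  proof -
    define z where "z = inverse w"
    define X where "X = mat_inv (z \<cdot>\<^sub>m 1\<^sub>m m - F')"
    define a where "a = X * G'"
    have wz: "w * z = 1" "z \<noteq> 0"
      using w by (auto simp: z_def)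
    have "norm z > 1"
      using w by (simp add: z_def norm_inverse one_less_inverse)
    then have ne: "\<not> eigenvalue F' z"
      using st by (auto simp: stable_mat_def F'_def)
    have Yc: "z \<cdot>\<^sub>m 1\<^sub>m m - F' \<in> carrier_mat m m"
      by (simp add: minus_carrier_mat)
    note inv = mat_inv_right[OF Yc invertible_resolvent[OF _ ne], folded X_def]
    have Xc[simp]: "X \<in> carrier_mat m m"
      using inv by simp
    have ac[simp]: "a \<in> carrier_mat m 1"
      by (simp add: a_def mult_carrier_mat[of _ m m])
    have "(z \<cdot>\<^sub>m 1\<^sub>m m - F') * a = (z \<cdot>\<^sub>m 1\<^sub>m m - F') * X * G'"
      unfolding a_def using Yc by (simp add: assoc_mult_mat[of _ m m _ m _ 1])
    also have "\<dots> = G'"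
      using inv(2) left_mult_one_mat[of G' m 1] by simp
    also have "(z \<cdot>\<^sub>m 1\<^sub>m m - F') * a = z \<cdot>\<^sub>m a - F' * a"
      by (subst minus_mult_distrib_mat[of _ m m _ _ 1]) (auto simp: mult_smult_assoc_mat[of _ m m _ 1] left_mult_one_mat[of a m 1])
    finally have za: "z \<cdot>\<^sub>m a - F' * a = G'" .
    have ent: "z * a $$ (i, 0) = G' $$ (i, 0) + (\<Sum>k<m. F' $$ (i, k) * a $$ (k, 0))" if "i < m" for i
    proof -
      have "(z \<cdot>\<^sub>m a - F' * a) $$ (i, 0) = G' $$ (i, 0)"
        using za by simp
      then show ?thesis
        using that index_mult_mat_sum[of F' m m a 1 i 0] carrier_matD[of a m 1] carrier_matD[of F' m m]
        by (auto simp: algebra_simps)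
    qed
    \<comment> \<open>Iterating \<open>step\<close> finitely often replaces a convergent Neumann series of the resolvent.\<close>
    have step: "q j a = w * p (Suc j) + w * q (Suc j) a" for j
    proof -
      have "q (Suc j) a = (H' * F' ^\<^sub>m j * (F' * a)) $$ (0, 0)"
        unfolding q_def by (simp add: assoc_mult_mat[of _ 1 m _ m _ 1] assoc_mult_mat[of _ 1 m _ m _ m, symmetric])
      moreover have "F' * a = z \<cdot>\<^sub>m a - G'"
        unfolding za[symmetric] by (intro eq_matI) auto
      moreover have "H' * F' ^\<^sub>m j * (z \<cdot>\<^sub>m a - G') = z \<cdot>\<^sub>m (H' * F' ^\<^sub>m j * a) - H' * F' ^\<^sub>m j * G'"
        by (subst mult_minus_distrib_mat[of _ 1 m _ 1]) (auto simp: mult_smult_distrib[of _ 1 m _ 1])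
      moreover have "H' * F' ^\<^sub>m j * a \<in> carrier_mat 1 1" "H' * F' ^\<^sub>m j * G' \<in> carrier_mat 1 1"
        by (auto intro!: mult_carrier_mat[of _ 1 m])
      ultimately have "q (Suc j) a = z * q j a - p (Suc j)"
        unfolding p_Suc q_def
        using carrier_matD[of H' 1 m] carrier_matD[of G' m 1] carrier_matD[of a m 1] by auto
      then have "w * p (Suc j) + w * q (Suc j) a = (w * z) * q j a"
        by (simp add: mult.assoc flip: distrib_left)
      then show ?thesis
        using wz by simp
    qed
    have exp: "q 0 a = (\<Sum>k<J. w ^ Suc k * p (Suc k)) + w ^ J * q J a" for J
    proof (induction J)
      case (Suc J)
      then show ?case
        using step[of J] by (simp add: algebra_simps)
    qed simp
    have "f z = (H' * X * G') $$ (0, 0) + p 0"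
      using re ne by (simp add: realization_def X_def F'_def G'_def H'_def p_def)
    also have "H' * X * G' = H' * F' ^\<^sub>m 0 * a"
      using carrier_matD[of F' m m] right_mult_one_mat[of H' 1 m] by (simp add: a_def assoc_mult_mat[of _ 1 m _ m _ 1])
    also have "(H' * F' ^\<^sub>m 0 * a) $$ (0, 0) = q 0 a"
      by (simp add: q_def)
    also have "\<dots> = (\<Sum>k<K. w ^ Suc k * p (Suc k)) + w ^ K * q K a"
      by (rule exp)
    also have "\<dots> + p 0 = (\<Sum>k\<le>K. w ^ k * p k) + w ^ K * q K a"
      by (subst lessThan_Suc_atMost[symmetric], subst sum.lessThan_Suc_shift) simp
    finally have fz: "f z - (\<Sum>k\<le>K. w ^ k * p k) = w ^ K * q K a"
      by simp
    \<comment> \<open>Summing the entries of z a = G + F a gives |z| S <= g + c S. Multiplying by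
      |w| yields S <= |w| g + S / 2, hence S <= 2 g |w|.\<close>
    define S where "S = (\<Sum>i<m. norm (a $$ (i, 0)))"
    have S0: "S \<ge> 0"
      by (auto simp: S_def intro!: sum_nonneg)
    have le_S: "norm (a $$ (k, 0)) \<le> S" if "k < m" for k
      unfolding S_def using that by (intro member_le_sum) auto
    have "norm z * S = (\<Sum>i<m. norm (z * a $$ (i, 0)))"
      by (simp add: S_def sum_distrib_left norm_mult)
    also have "\<dots> \<le> (\<Sum>i<m. norm (G' $$ (i, 0)) + (\<Sum>k<m. norm (F' $$ (i, k)) * S))"
    proof (intro sum_mono)
      fix i assume "i \<in> {..<m}"
      then have "norm (z * a $$ (i, 0)) \<le> norm (G' $$ (i, 0)) + norm (\<Sum>k<m. F' $$ (i, k) * a $$ (k, 0))"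
        using ent norm_triangle_ineq by simp
      also have "norm (\<Sum>k<m. F' $$ (i, k) * a $$ (k, 0)) \<le> (\<Sum>k<m. norm (F' $$ (i, k)) * S)"
        by (intro sum_norm_le) (auto simp: norm_mult intro!: mult_left_mono le_S)
      finally show "norm (z * a $$ (i, 0)) \<le> norm (G' $$ (i, 0)) + (\<Sum>k<m. norm (F' $$ (i, k)) * S)"
        by simp
    qed
    also have "\<dots> = g + c * S"
      by (simp add: g_def c_def sum.distrib sum_distrib_right)
    finally have "norm w * (norm z * S) \<le> norm w * (g + c * S)"
      by (intro mult_left_mono) auto
    moreover have "norm w * norm z = 1"
      using wz(1) by (metis norm_mult norm_one)
    then have "norm w * (norm z * S) = S"
      by (simp flip: mult.assoc)
    ultimately have "S \<le> norm w * g + (norm w * c) * S"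
      by (simp add: distrib_left mult.assoc)
    also have "(norm w * c) * S \<le> (1 / 2) * S"
      using w S0 by (intro mult_right_mono) auto
    finally have S_le: "S \<le> 2 * g * norm w"
      by (simp add: algebra_simps)
    have "q K a = (\<Sum>i<m. (H' * F' ^\<^sub>m K) $$ (0, i) * a $$ (i, 0))"
      unfolding q_def by (rule index_mult_mat_sum[of _ 1 m _ 1]) simp_all
    also have "norm \<dots> \<le> (\<Sum>i<m. norm ((H' * F' ^\<^sub>m K) $$ (0, i)) * S)"
      by (intro sum_norm_le) (auto simp: norm_mult intro!: mult_left_mono le_S)
    also have "\<dots> = h * S"
      by (simp add: h_def sum_distrib_right)
    also have "\<dots> \<le> h * (2 * g * norm w)"
      using S_le h0 by (intro mult_left_mono)
    finally have "norm (w ^ K * q K a) \<le> norm w ^ K * (h * (2 * g * norm w))"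
      by (simp add: norm_mult norm_power mult_left_mono)
    then show ?thesis
      unfolding fz[symmetric] by (simp add: z_def mult_ac)
  qed
  note bound = this
  have "\<forall>\<^sub>F w in at (0::complex). w \<noteq> 0"
    by (simp add: eventually_at_filter)
  moreover have "\<forall>\<^sub>F w in at (0::complex). norm w < 1"
    by (rule order_tendstoD) (auto intro!: tendsto_eq_intros)
  moreover have "\<forall>\<^sub>F w in at (0::complex). norm w * (2 * c) < 1"
    by (rule order_tendstoD) (auto intro!: tendsto_eq_intros)
  ultimately have "\<forall>\<^sub>F w in at 0.
    norm (f (inverse w) - (\<Sum>k\<le>K. w ^ k * p k)) \<le> h * (2 * g) * norm w ^ Suc K"
    by eventually_elim (rule bound, simp_all)
  then show ?thesis
    unfolding p_def by blast
qed

text \<open>Multiply numerator and denominator by the larger power of w = 1/z and let w tend to 0.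
  The reflected polynomials tend to the leading coefficients, so a gap \<open>e\<close> in the
  degrees would leave a factor 0 ^ e and force a nonzero leading coefficient to be 0. Equal degrees
  are what makes reflecting each polynomial separately the same as substituting 1/w in the
  quotient.\<close>

lemma transfer_limit_degree:
  assumes smp: "stable_minimum_phase num den"
    and lim: "(transfer_fun num den \<longlongrightarrow> 1) at_infinity"
  shows "num \<noteq> 0" "den \<noteq> 0" "degree num = degree den"
proof -
  show nz: "num \<noteq> 0"
  proof
    assume "num = 0"
    then have "transfer_fun num den = (\<lambda>_. 0)"
      by (auto simp: transfer_fun_def)
    with lim have "((\<lambda>_. 0) \<longlongrightarrow> (1::complex)) (at_infinity :: complex filter)"
      by simp
    then show False
      using tendsto_unique[OF trivial_limit_at_infinity] tendsto_const zero_neq_one by metis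
  qed
  show dz: "den \<noteq> 0"
  proof
    \<comment> \<open>Division by zero yields 0, so the transfer function would be identically 0,
      against its limit 1.\<close>
    assume "den = 0"
    then have "transfer_fun num den = (\<lambda>_. 0)"
      by (auto simp: transfer_fun_def)
    with lim have "((\<lambda>_. 0) \<longlongrightarrow> (1::complex)) (at_infinity :: complex filter)"
      by simp
    then show False
      using tendsto_unique[OF trivial_limit_at_infinity] tendsto_const zero_neq_one by metis
  qed
  define p where "p = map_poly complex_of_real num"
  define q where "q = map_poly complex_of_real den"
  have deg: "degree p = degree num" "degree q = degree den"
    by (simp_all add: p_def q_def)
  have pq0: "p \<noteq> 0" "q \<noteq> 0"
    using nz dz by (auto simp: p_def q_def)
  define tf where "tf w = transfer_fun num den (inverse w)" for w
  have tf: "(tf \<longlongrightarrow> 1) (at 0)"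
    unfolding tf_def by (rule filterlim_compose[OF lim filterlim_inverse_at_infinity])
  have "\<forall>\<^sub>F w in at (0::complex). w \<noteq> 0"
    by (simp add: eventually_at_filter)
  moreover have "\<forall>\<^sub>F w in at (0::complex). norm w < 1"
    by (rule order_tendstoD) (auto intro!: tendsto_eq_intros)
  ultimately have ev: "\<forall>\<^sub>F w in at 0. w \<noteq> 0 \<and> poly p (inverse w) = poly q (inverse w) * tf w"
  proof eventually_elim
    case (elim w)
    then have "norm (inverse w) > 1"
      by (simp add: norm_inverse one_less_inverse)
    then have "poly q (inverse w) \<noteq> 0"
      using smp by (auto simp: stable_minimum_phase_def q_def)
    with elim show ?case
      by (simp add: tf_def transfer_fun_def p_def q_def)
  qed
  have reflect_p: "((\<lambda>w. poly (reflect_poly p) w) \<longlongrightarrow> lead_coeff p) (at 0)"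
    by (rule tendsto_eq_intros refl)+ simp
  have reflect_q: "((\<lambda>w. poly (reflect_poly q) w) \<longlongrightarrow> lead_coeff q) (at 0)"
    by (rule tendsto_eq_intros refl)+ simp
  show "degree num = degree den"
  proof (rule linorder_cases)
    assume less: "degree num < degree den"
    define e where "e = degree den - degree num"
    have "((\<lambda>w. w ^ e * poly (reflect_poly p) w) \<longlongrightarrow> 0 ^ e * lead_coeff p) (at 0)"
      by (intro tendsto_intros reflect_p)
    moreover have "\<forall>\<^sub>F w in at 0. w ^ e * poly (reflect_poly p) w = poly (reflect_poly q) w * tf w"
      using ev
    proof eventually_elim
      case (elim w)
      have "degree q = e + degree p"
        using less deg by (simp add: e_def)
      then show ?case
        using elim by (simp add: poly_reflect_poly_nz power_add)
    qed
    ultimately have "((\<lambda>w. poly (reflect_poly q) w * tf w) \<longlongrightarrow> 0 ^ e * lead_coeff p) (at 0)"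
      using tendsto_cong by fast
    moreover have "((\<lambda>w. poly (reflect_poly q) w * tf w) \<longlongrightarrow> lead_coeff q * 1) (at 0)"
      by (intro tendsto_intros reflect_q tf)
    ultimately have "0 ^ e * lead_coeff p = lead_coeff q * 1"
      using tendsto_unique[OF at_neq_bot] by blast
    then show ?thesis
      using less pq0 by (simp add: e_def power_0_left)
  next
    assume less: "degree den < degree num"
    define e where "e = degree num - degree den"
    have "((\<lambda>w. w ^ e * poly (reflect_poly q) w * tf w) \<longlongrightarrow> 0 ^ e * lead_coeff q * 1) (at 0)"
      by (intro tendsto_intros reflect_q tf)
    moreover have "\<forall>\<^sub>F w in at 0. w ^ e * poly (reflect_poly q) w * tf w = poly (reflect_poly p) w"
      using ev
    proof eventually_elim
      case (elim w)
      have "degree p = e + degree q"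
        using less deg by (simp add: e_def)
      then show ?case
        using elim by (simp add: poly_reflect_poly_nz power_add)
    qed
    ultimately have "(poly (reflect_poly p) \<longlongrightarrow> 0 ^ e * lead_coeff q * 1) (at 0)"
      using tendsto_cong by fast
    then have "0 ^ e * lead_coeff q * 1 = lead_coeff p"
      using tendsto_unique[OF at_neq_bot] reflect_p by blast
    then show ?thesis
      using less pq0 by (simp add: e_def power_0_left)
  qed
qed

text \<open>The cleared form num * h = den of h = den / num, proved one coefficient at a time.
  Coefficient K sees only the first K + 1 Markov parameters, so h may be replaced by a polynomial
  truncation; the difference of the two sides is then a polynomial of order w^(K+1) at 0.\<close>

lemma markov_parameters_inverse_transfer:
  assumes smp: "stable_minimum_phase num den"
    and lim: "(transfer_fun num den \<longlongrightarrow> 1) at_infinity"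
    and re: "realization (\<lambda>z. 1 / transfer_fun num den z) m F G H D"
    and st: "stable_mat F"
  shows "fps_of_poly (reflect_poly num) * Abs_fps (markov_parameter F G H D) =
    fps_of_poly (reflect_poly den)"
proof (rule fps_ext)
  fix K
  note deg = transfer_limit_degree[OF smp lim]
  define p where "p = map_poly complex_of_real num"
  define q where "q = map_poly complex_of_real den"
  define h where "h k = complex_of_real (markov_parameter F G H D k)" for k
  define hK where "hK = (\<Sum>k\<le>K. monom (h k) k)"
  have coeff_p: "coeff (reflect_poly p) i = complex_of_real (coeff (reflect_poly num) i)" for i
    by (simp add: coeff_reflect_poly p_def)
  have coeff_q: "coeff (reflect_poly q) i = complex_of_real (coeff (reflect_poly den) i)" for i
    by (simp add: coeff_reflect_poly q_def)
  obtain C where C: "\<forall>\<^sub>F w in at 0.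
      norm (1 / transfer_fun num den (inverse w) - (\<Sum>k\<le>K. w ^ k * h k)) \<le> C * norm w ^ Suc K"
    using realization_expansion[OF re st] unfolding h_def by blast
  have "\<forall>\<^sub>F w in at (0::complex). w \<noteq> 0"
    by (simp add: eventually_at_filter)
  moreover have "\<forall>\<^sub>F w in at (0::complex). norm w < 1"
    by (rule order_tendstoD) (auto intro!: tendsto_eq_intros)
  \<comment> \<open>The reflected numerator takes the value \<open>lead_coeff p\<close> at 0, so
    near 0 its norm stays below that of \<open>lead_coeff p\<close> plus 1.\<close>
  moreover have "\<forall>\<^sub>F w in at 0. norm (poly (reflect_poly p) w) < norm (lead_coeff p) + 1"
    by (rule order_tendstoD) (auto intro!: tendsto_eq_intros)
  ultimately have "\<forall>\<^sub>F w in at 0. norm (poly (reflect_poly q - reflect_poly p * hK) w)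
      \<le> (norm (lead_coeff p) + 1) * C * norm w ^ Suc K"
    using C
  proof eventually_elim
    case (elim w)
    let ?d = "1 / transfer_fun num den (inverse w) - (\<Sum>k\<le>K. w ^ k * h k)"
    \<comment> \<open>Minimum phase: the numerator has no zero at 1/w, so it can be
      cancelled.\<close>
    from elim have "norm (inverse w) > 1"
      by (simp add: norm_inverse one_less_inverse)
    then have nz: "poly p (inverse w) \<noteq> 0"
      using smp by (auto simp: stable_minimum_phase_def p_def)
    have "1 / transfer_fun num den (inverse w) = poly q (inverse w) / poly p (inverse w)"
      by (simp add: transfer_fun_def p_def q_def)
    then have "poly (reflect_poly p) w * (1 / transfer_fun num den (inverse w)) = poly (reflect_poly q) w"
      using nz elim(1) deg(3) by (simp add: poly_reflect_poly_nz p_def q_def)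
    moreover have "poly hK w = (\<Sum>k\<le>K. w ^ k * h k)"
      by (simp add: hK_def poly_sum poly_monom mult.commute)
    ultimately have "poly (reflect_poly q - reflect_poly p * hK) w = poly (reflect_poly p) w * ?d"
      by (simp add: algebra_simps)
    also have "norm \<dots> \<le> (norm (lead_coeff p) + 1) * (C * norm w ^ Suc K)"
      unfolding norm_mult using elim(3,4) by (intro mult_mono) auto
    finally show ?case
      by (simp add: mult_ac)
  qed
  then have "coeff (reflect_poly q - reflect_poly p * hK) K = 0"
    by (rule poly_coeff_eq_0_if_bigo) simp
  then have "coeff (reflect_poly q) K = (\<Sum>i\<le>K. coeff (reflect_poly p) i * coeff hK (K - i))"
    by (simp add: coeff_mult)
  also have "\<dots> = (\<Sum>i\<le>K. coeff (reflect_poly p) i * h (K - i))"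
    by (intro sum.cong refl) (simp add: hK_def coeff_sum)
  finally have "complex_of_real (coeff (reflect_poly den) K) =
      complex_of_real (\<Sum>i\<le>K. coeff (reflect_poly num) i * markov_parameter F G H D (K - i))"
    by (simp add: coeff_p coeff_q h_def)
  then have "coeff (reflect_poly den) K =
      (\<Sum>i\<le>K. coeff (reflect_poly num) i * markov_parameter F G H D (K - i))"
    by (simp only: of_real_eq_iff)
  then show "fps_nth (fps_of_poly (reflect_poly num) * Abs_fps (markov_parameter F G H D)) K =
      fps_nth (fps_of_poly (reflect_poly den)) K"
    by (simp add: fps_mult_nth atLeast0AtMost)
qed

text \<open>Lower triangular Toeplitz matrices represent power series modulo X^(T+1), so their
  product is the convolution of the coefficients.\<close>

lemma toeplitz_mult:
  "toeplitz T (fps_nth f) * toeplitz T (fps_nth g) = toeplitz T (fps_nth (f * g))"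
proof (rule eq_matI)
  fix i j assume "i < dim_row (toeplitz T (fps_nth (f * g)))" "j < dim_col (toeplitz T (fps_nth (f * g)))"
  then have ij: "i < T + 1" "j < T + 1"
    by (auto simp: toeplitz_def)
  have "(toeplitz T (fps_nth f) * toeplitz T (fps_nth g)) $$ (i, j) =
      (\<Sum>k<T + 1. (if k \<le> i then fps_nth f (i - k) else 0) * (if j \<le> k then fps_nth g (k - j) else 0))"
    using ij by (subst index_mult_mat_sum[of _ "T + 1" "T + 1" _ "T + 1"]) (auto simp: toeplitz_def)
  also have "\<dots> = (\<Sum>k\<in>{j..i}. fps_nth f (i - k) * fps_nth g (k - j))"
    using ij by (intro sum.mono_neutral_cong_right) auto
  also have "\<dots> = (if j \<le> i then \<Sum>l=0..i - j. fps_nth f l * fps_nth g (i - j - l) else 0)"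
  proof (cases "j \<le> i")
    case True
    then have "(\<Sum>k\<in>{j..i}. fps_nth f (i - k) * fps_nth g (k - j)) =
        (\<Sum>l=0..i - j. fps_nth f l * fps_nth g (i - j - l))"
      by (intro sum.reindex_bij_witness[of _ "\<lambda>l. i - l" "\<lambda>k. i - k"]) auto
    with True show ?thesis by simp
  qed auto
  also have "\<dots> = toeplitz T (fps_nth (f * g)) $$ (i, j)"
    using ij by (simp add: toeplitz_def fps_mult_nth)
  finally show "(toeplitz T (fps_nth f) * toeplitz T (fps_nth g)) $$ (i, j) =
      toeplitz T (fps_nth (f * g)) $$ (i, j)" .
qed (auto simp: toeplitz_def)

text \<open>The bridge from transfer function to state space. The reflected denominator has the
  nonzero leading coefficient of \<open>den\<close> as its constant term and is therefore a unit
  among power series, so the identity num * h = den becomes (num / den) * h = 1, which passes to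
  Toeplitz matrices.\<close>

lemma inverse_channel_mat:
  assumes smp: "stable_minimum_phase num den"
    and lim: "(transfer_fun num den \<longlongrightarrow> 1) at_infinity"
    and re: "realization (\<lambda>z. 1 / transfer_fun num den z) m F G H D"
    and st: "stable_mat F"
  shows "mat_inv (channel_mat T num den) = toeplitz T (markov_parameter F G H D)"
proof -
  let ?n = "fps_of_poly (reflect_poly num)" and ?d = "fps_of_poly (reflect_poly den)"
  let ?h = "Abs_fps (markov_parameter F G H D)"
  have d0: "fps_nth ?d 0 \<noteq> 0"
    using transfer_limit_degree[OF smp lim] by simp
  have "(?n / ?d) * ?h = inverse ?d * (?n * ?h)"
    using d0 by (simp add: fps_divide_unit mult_ac)
  also have "\<dots> = 1"
    unfolding markov_parameters_inverse_transfer[OF assms] using d0 by (rule inverse_mult_eq_1)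
  finally have one: "(?n / ?d) * ?h = 1" .
  have "channel_mat T num den * toeplitz T (markov_parameter F G H D) =
      toeplitz T (fps_nth (?n / ?d)) * toeplitz T (fps_nth ?h)"
    by (simp add: channel_mat_def impulse_response_def Abs_fps_inverse)
  also have "\<dots> = toeplitz T (fps_nth 1)"
    by (simp add: toeplitz_mult one)
  also have "\<dots> = 1\<^sub>m (T + 1)"
    by (rule eq_matI) (auto simp: toeplitz_def)
  finally show ?thesis
    by (intro mat_inv_eqI[of _ "T + 1"]) (auto simp: channel_mat_def toeplitz_def)
qed

section \<open>The closed loop\<close>

text \<open>These equations apply at every time, without a pattern on \<open>t\<close>, and call
  each other; as simp rules they would unfold forever.\<close>

declare channel_input.simps [simp del] channel_output.simps [simp del]

lemma channel_state_carrier: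
  assumes "F \<in> carrier_mat m m" "G \<in> carrier_mat m 1"
  shows "channel_state F G H L r v t \<in> carrier_vec m"
  using assms by (induction t) auto

text \<open>The power \<open>F ^\<^sub>m j\<close> is there for the induction: the update of the
  state multiplies by F and so raises \<open>j\<close> by one. The index j + t - k is positive for k
  < t, so \<open>D\<close> is never met and may be arbitrary.\<close>

lemma channel_state_response:
  assumes F: "F \<in> carrier_mat m m" and G: "G \<in> carrier_mat m 1" and H: "H \<in> carrier_mat 1 m"
  shows "vec_index (H * F ^\<^sub>m j *\<^sub>v channel_state F G H L r v t) 0 =
    (\<Sum>k<t. markov_parameter F G H D (j + t - k) * channel_input F G H L r v k)"
proof (induction t arbitrary: j)
  case 0
  have "H * F ^\<^sub>m j \<in> carrier_mat 1 m"
    using F H pow_carrier_mat[OF F] by (simp add: mult_carrier_mat[of _ 1 m])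
  then show ?case
    using F by (subst index_mult_mat_vec_sum[of _ 1 m]) auto
next
  case (Suc t)
  let ?s = "channel_state F G H L r v t" and ?u = "channel_input F G H L r v t"
  let ?M = "H * F ^\<^sub>m j"
  have s: "?s \<in> carrier_vec m"
    by (rule channel_state_carrier[OF F G])
  have Fj: "F ^\<^sub>m j \<in> carrier_mat m m"
    by (rule pow_carrier_mat[OF F])
  have M: "?M \<in> carrier_mat 1 m"
    by (rule mult_carrier_mat[OF H Fj])
  have g: "col G 0 \<in> carrier_vec m"
    using G by auto
  have "?M *\<^sub>v channel_state F G H L r v (Suc t) = ?M *\<^sub>v (F *\<^sub>v ?s) + ?M *\<^sub>v (?u \<cdot>\<^sub>v col G 0)"
    using F s M g by (simp add: mult_add_distrib_mat_vec[of _ 1 m])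
  also have "?M *\<^sub>v (F *\<^sub>v ?s) = (?M * F) *\<^sub>v ?s"
    by (rule assoc_mult_mat_vec[OF M F s, symmetric])
  also have "?M * F = H * F ^\<^sub>m Suc j"
    using assoc_mult_mat[OF H Fj F] by simp
  also have "?M *\<^sub>v (?u \<cdot>\<^sub>v col G 0) = ?u \<cdot>\<^sub>v (?M *\<^sub>v col G 0)"
    by (rule mult_mat_vec[OF M g])
  finally have "vec_index (?M *\<^sub>v channel_state F G H L r v (Suc t)) 0 =
      vec_index (H * F ^\<^sub>m Suc j *\<^sub>v ?s) 0 + ?u * vec_index (?M *\<^sub>v col G 0) 0"
    using M H F by simp
  also have "vec_index (?M *\<^sub>v col G 0) 0 = markov_parameter F G H D (Suc j)"
    using carrier_matD[OF M] carrier_matD[OF G] by simp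
  also have "vec_index (H * F ^\<^sub>m Suc j *\<^sub>v ?s) 0 =
      (\<Sum>k<t. markov_parameter F G H D (Suc j + t - k) * channel_input F G H L r v k)"
    by (rule Suc.IH)
  finally show ?case
    by (simp del: markov_parameter.simps)
qed

lemma channel_output_response:
  assumes F: "F \<in> carrier_mat m m" and G: "G \<in> carrier_mat m 1" and H: "H \<in> carrier_mat 1 m"
  shows "channel_output F G H L r v t =
    (\<Sum>k\<le>t. markov_parameter F G H 1 (t - k) * channel_input F G H L r v k) + v t"
proof -
  have "H * F ^\<^sub>m 0 = H"
    using F H by simp
  then have "vec_index (H *\<^sub>v channel_state F G H L r v t) 0 =
      (\<Sum>k<t. markov_parameter F G H 1 (t - k) * channel_input F G H L r v k)"
    using channel_state_response[OF assms, of 0 L r v t 1] by simp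
  \<comment> \<open>The parameter with index 0 is 1, so the direct feedthrough of the input is the
    term k = t of the longer sum.\<close>
  then show ?thesis
    by (simp add: channel_output.simps flip: lessThan_Suc_atMost)
qed

lemma lower_triangular_toeplitz: "lower_triangular T (toeplitz T h)"
  by (auto simp: lower_triangular_def toeplitz_def)

lemma feedback_loop_solution:
  assumes P: "lower_triangular T P" and L: "strictly_lower T L"
  defines "n \<equiv> T + 1"
  assumes vc: "r \<in> carrier_vec n" "v \<in> carrier_vec n" "y \<in> carrier_vec n"
    and y: "y = P *\<^sub>v u + v" and u: "u = r + L *\<^sub>v y"
  shows "y = mat_inv (1\<^sub>m n - P * L) *\<^sub>v (P *\<^sub>v r + v)"
    and "u = r - feedback_dual T P L *\<^sub>v (P *\<^sub>v r + v)"
proof -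
  define B where "B = mat_inv (1\<^sub>m n - P * L)"
  have Pc: "P \<in> carrier_mat n n" and Lc: "L \<in> carrier_mat n n"
    using L P by (auto simp: lower_triangular_def strictly_lower_def n_def)
  have PL: "P * L \<in> carrier_mat n n"
    using Pc Lc by simp
  note inv = inverse_one_minus_strictly_lower[OF strictly_lower_mult_left[OF P L], folded n_def, folded B_def]
  have Bc: "B \<in> carrier_mat n n"
    using inv(1) by (auto simp: lower_triangular_def n_def)
  \<comment> \<open>Each intermediate vector gets a name and a dimension, since the distributive
    laws for matrices and vectors ask for both.\<close>
  define a where "a = P *\<^sub>v r"
  define c where "c = L *\<^sub>v y"
  define d where "d = P *\<^sub>v c"
  define b where "b = a + v"
  have ac: "a \<in> carrier_vec n" and cc: "c \<in> carrier_vec n"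
    using Pc Lc vc by (auto simp: a_def c_def)
  then have dc: "d \<in> carrier_vec n" and bc: "b \<in> carrier_vec n"
    using Pc vc by (auto simp: d_def b_def)
  have "y = P *\<^sub>v (r + c) + v"
    using y u by (simp add: c_def)
  also have "P *\<^sub>v (r + c) = a + d"
    unfolding a_def d_def by (rule mult_add_distrib_mat_vec[OF Pc vc(1) cc])
  finally have yd: "y = a + d + v" .
  have "(1\<^sub>m n - P * L) *\<^sub>v y = 1\<^sub>m n *\<^sub>v y - (P * L) *\<^sub>v y"
    by (rule minus_mult_distrib_mat_vec[OF _ PL vc(3)]) simp
  also have "\<dots> = y - d"
    using assoc_mult_mat_vec[OF Pc Lc vc(3)] one_mult_mat_vec[OF vc(3)] by (simp add: c_def d_def)
  also have "\<dots> = b"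
    unfolding yd b_def using ac dc vc(2) by (intro eq_vecI) auto
  finally have "B *\<^sub>v ((1\<^sub>m n - P * L) *\<^sub>v y) = B *\<^sub>v b"
    by simp
  moreover have "B *\<^sub>v ((1\<^sub>m n - P * L) *\<^sub>v y) = (B * (1\<^sub>m n - P * L)) *\<^sub>v y"
    by (rule assoc_mult_mat_vec[OF Bc minus_carrier_mat[OF PL] vc(3), symmetric])
  ultimately have yB: "y = B *\<^sub>v b"
    unfolding inv(3) one_mult_mat_vec[OF vc(3)] by simp
  then show "y = mat_inv (1\<^sub>m n - P * L) *\<^sub>v (P *\<^sub>v r + v)"
    by (simp add: B_def b_def a_def)
  have LB: "feedback_dual T P L = - (L * B)"
    unfolding feedback_dual_def using Lc Bc by (simp add: B_def n_def)
  have "(L * B) *\<^sub>v b = c"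
    using assoc_mult_mat_vec[OF Lc Bc bc] yB by (simp add: c_def)
  then have "feedback_dual T P L *\<^sub>v b = - c"
    unfolding LB using mult_carrier_mat[OF Lc Bc] carrier_matD[OF Lc] carrier_matD[OF Bc] bc cc
    by (intro eq_vecI)
      (auto simp: index_mult_mat_vec_sum[of _ n n] simp del: index_mult_mat_vec
        simp flip: sum_negf intro!: sum.cong)
  moreover have "u = r + c"
    using u by (simp add: c_def)
  ultimately have "u = r - feedback_dual T P L *\<^sub>v b"
    using cc vc(1) by (intro eq_vecI) auto
  then show "u = r - feedback_dual T P L *\<^sub>v (P *\<^sub>v r + v)"
    by (simp add: b_def a_def)
qed

text \<open>Passes from the causal recursion to vector equations: the sums up to time t are extended
  to the whole horizon by the zeros of the triangular matrices \<open>L\<close> and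
  \<open>P\<close>.\<close>

lemma closed_loop:
  fixes T r v and F G H L :: "real mat"
  defines "n \<equiv> T + 1"
  defines "P \<equiv> toeplitz T (markov_parameter F G H 1)"
  assumes F: "F \<in> carrier_mat m m" and G: "G \<in> carrier_mat m 1" and H: "H \<in> carrier_mat 1 m"
    and L: "strictly_lower T L"
  shows "Matrix.vec n (channel_output F G H L r v) =
      mat_inv (1\<^sub>m n - P * L) *\<^sub>v (P *\<^sub>v Matrix.vec n r + Matrix.vec n v)" (is "?y = _")
    and "Matrix.vec n (channel_input F G H L r v) =
      Matrix.vec n r - feedback_dual T P L *\<^sub>v (P *\<^sub>v Matrix.vec n r + Matrix.vec n v)" (is "?u = _")
proof -
  let ?r = "Matrix.vec n r" and ?v = "Matrix.vec n v"
  have Pl: "lower_triangular T P"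
    unfolding P_def by (rule lower_triangular_toeplitz)
  have Pc: "P \<in> carrier_mat n n" and Lc: "L \<in> carrier_mat n n"
    using L Pl by (auto simp: lower_triangular_def strictly_lower_def n_def)
  have vc: "?r \<in> carrier_vec n" "?v \<in> carrier_vec n" "?y \<in> carrier_vec n" "?u \<in> carrier_vec n"
    by auto
  have u: "?u = ?r + L *\<^sub>v ?y"
  proof (rule eq_vecI)
    fix t assume "t < dim_vec (?r + L *\<^sub>v ?y)"
    then have t: "t < n"
      using Lc by simp
    have "vec_index (L *\<^sub>v ?y) t = (\<Sum>k<n. L $$ (t, k) * channel_output F G H L r v k)"
      using t by (subst index_mult_mat_vec_sum[OF Lc]) auto
    also have "\<dots> = (\<Sum>k<t. L $$ (t, k) * channel_output F G H L r v k)"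
      using t L by (intro sum.mono_neutral_right) (auto simp: strictly_lower_def n_def)
    finally show "vec_index ?u t = vec_index (?r + L *\<^sub>v ?y) t"
      using t Lc by (simp add: channel_input.simps)
  qed (use Lc in auto)
  have y: "?y = P *\<^sub>v ?u + ?v"
  proof (rule eq_vecI)
    fix t assume "t < dim_vec (P *\<^sub>v ?u + ?v)"
    then have t: "t < n"
      by simp
    have "vec_index (P *\<^sub>v ?u) t = (\<Sum>k<n. P $$ (t, k) * channel_input F G H L r v k)"
      using t by (subst index_mult_mat_vec_sum[OF Pc]) auto
    also have "\<dots> = (\<Sum>k\<le>t. markov_parameter F G H 1 (t - k) * channel_input F G H L r v k)"
      using t by (intro sum.mono_neutral_cong_right)
        (auto simp: P_def toeplitz_def n_def)
    finally show "vec_index ?y t = vec_index (P *\<^sub>v ?u + ?v) t"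
      using t Pc by (simp add: channel_output_response[OF F G H])
  qed auto
  from feedback_loop_solution[OF Pl L, folded n_def, OF vc(1,2,3) y u]
  show "?y = mat_inv (1\<^sub>m n - P * L) *\<^sub>v (P *\<^sub>v ?r + ?v)"
    and "?u = ?r - feedback_dual T P L *\<^sub>v (P *\<^sub>v ?r + ?v)"
    by blast+
qed

section \<open>Causal least-squares estimation\<close>

definition square_integrable :: "'a measure \<Rightarrow> ('a \<Rightarrow> real) \<Rightarrow> bool" where
  "square_integrable M X \<longleftrightarrow> X \<in> borel_measurable M \<and> integrable M (\<lambda>\<omega>. (X \<omega>)\<^sup>2)"

lemma integrable_mult_square_integrable:
  assumes "square_integrable M X" "square_integrable M Y"
  shows "integrable M (\<lambda>\<omega>. X \<omega> * Y \<omega>)"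
proof (rule Bochner_Integration.integrable_bound)
  show "integrable M (\<lambda>\<omega>. (X \<omega>)\<^sup>2 + (Y \<omega>)\<^sup>2)"
    using assms by (auto simp: square_integrable_def)
  show "(\<lambda>\<omega>. X \<omega> * Y \<omega>) \<in> borel_measurable M"
    using assms by (auto simp: square_integrable_def)
  show "AE \<omega> in M. norm (X \<omega> * Y \<omega>) \<le> norm ((X \<omega>)\<^sup>2 + (Y \<omega>)\<^sup>2)"
  proof (intro AE_I2)
    fix \<omega>
    have "2 * (\<bar>X \<omega>\<bar> * \<bar>Y \<omega>\<bar>) \<le> (X \<omega>)\<^sup>2 + (Y \<omega>)\<^sup>2"
      using zero_le_power2[of "\<bar>X \<omega>\<bar> - \<bar>Y \<omega>\<bar>"] by (simp add: power2_diff)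
    moreover have "0 \<le> \<bar>X \<omega>\<bar> * \<bar>Y \<omega>\<bar>"
      by simp
    ultimately show "norm (X \<omega> * Y \<omega>) \<le> norm ((X \<omega>)\<^sup>2 + (Y \<omega>)\<^sup>2)"
      unfolding real_norm_def abs_mult by linarith
  qed
qed

lemma square_integrable_add:
  assumes "square_integrable M X" "square_integrable M Y"
  shows "square_integrable M (\<lambda>\<omega>. X \<omega> + Y \<omega>)"
  using assms integrable_mult_square_integrable[OF assms]
  by (auto simp: square_integrable_def power2_sum mult.assoc)

lemma square_integrable_cmult:
  "square_integrable M X \<Longrightarrow> square_integrable M (\<lambda>\<omega>. c * X \<omega>)"
  by (auto simp: square_integrable_def power_mult_distrib)

lemma square_integrable_diff:
  assumes "square_integrable M X" "square_integrable M Y"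
  shows "square_integrable M (\<lambda>\<omega>. X \<omega> - Y \<omega>)"
  using square_integrable_add[OF assms(1) square_integrable_cmult[OF assms(2), of "-1"]] by simp

lemma square_integrable_sum:
  "(\<And>i. i \<in> I \<Longrightarrow> square_integrable M (X i)) \<Longrightarrow> square_integrable M (\<lambda>\<omega>. \<Sum>i\<in>I. X i \<omega>)"
  by (induction I rule: infinite_finite_induct)
    (auto intro: square_integrable_add simp: square_integrable_def[of _ "\<lambda>_. 0"])

lemma integral_mult_sum_right:
  assumes "square_integrable M X" "\<And>j. j \<in> J \<Longrightarrow> square_integrable M (Y j)"
  shows "(\<integral>\<omega>. X \<omega> * (\<Sum>j\<in>J. b j * Y j \<omega>) \<partial>M) = (\<Sum>j\<in>J. b j * (\<integral>\<omega>. X \<omega> * Y j \<omega> \<partial>M))"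
proof -
  have "(\<integral>\<omega>. X \<omega> * (\<Sum>j\<in>J. b j * Y j \<omega>) \<partial>M) = (\<integral>\<omega>. (\<Sum>j\<in>J. b j * (X \<omega> * Y j \<omega>)) \<partial>M)"
    by (simp add: sum_distrib_left mult_ac)
  also have "\<dots> = (\<Sum>j\<in>J. (\<integral>\<omega>. b j * (X \<omega> * Y j \<omega>) \<partial>M))"
    using assms by (intro Bochner_Integration.integral_sum integrable_mult_right integrable_mult_square_integrable)
  finally show ?thesis
    by simp
qed

lemma integral_sum_mult_sum:
  assumes X: "\<And>i. i \<in> I \<Longrightarrow> square_integrable M (X i)" and Y: "\<And>j. j \<in> J \<Longrightarrow> square_integrable M (Y j)"
  shows "(\<integral>\<omega>. (\<Sum>i\<in>I. a i * X i \<omega>) * (\<Sum>j\<in>J. b j * Y j \<omega>) \<partial>M) =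
    (\<Sum>i\<in>I. \<Sum>j\<in>J. a i * b j * (\<integral>\<omega>. X i \<omega> * Y j \<omega> \<partial>M))"
proof -
  have "(\<integral>\<omega>. (\<Sum>i\<in>I. a i * X i \<omega>) * (\<Sum>j\<in>J. b j * Y j \<omega>) \<partial>M) =
      (\<integral>\<omega>. (\<Sum>j\<in>J. b j * Y j \<omega>) * (\<Sum>i\<in>I. a i * X i \<omega>) \<partial>M)"
    by (simp add: mult.commute)
  also have "\<dots> = (\<Sum>i\<in>I. a i * (\<integral>\<omega>. X i \<omega> * (\<Sum>j\<in>J. b j * Y j \<omega>) \<partial>M))"
    using X by (subst integral_mult_sum_right)
      (auto intro!: square_integrable_sum square_integrable_cmult Y simp: mult.commute)
  also have "\<dots> = (\<Sum>i\<in>I. \<Sum>j\<in>J. a i * b j * (\<integral>\<omega>. X i \<omega> * Y j \<omega> \<partial>M))"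
    by (intro sum.cong refl, subst integral_mult_sum_right) (auto intro: X Y simp: sum_distrib_left mult.assoc)
  finally show ?thesis .
qed

text \<open>A kernel vector makes the quadratic form vanish and is therefore 0, so the matrix is
  invertible. \<open>S\<close> will be the Gram matrix of the observations before time t, and the
  system the normal equations of row t of the estimator.\<close>

lemma coercive_linear_system:
  fixes S :: "nat \<Rightarrow> nat \<Rightarrow> real"
  assumes coercive: "\<And>x. (\<Sum>i<t. (x i)\<^sup>2) \<le> (\<Sum>i<t. \<Sum>j<t. x i * x j * S i j)"
  shows "\<exists>k. \<forall>i<t. (\<Sum>j<t. S i j * k j) = b i"
proof -
  define A where "A = Matrix.mat t t (\<lambda>(i, j). S i j)"
  have A: "A \<in> carrier_mat t t"
    by (simp add: A_def)
  have Av: "vec_index (A *\<^sub>v v) i = (\<Sum>j<t. S i j * vec_index v j)" if "v \<in> carrier_vec t" "i < t" for v i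
    using index_mult_mat_vec_sum[OF A that] that by (simp add: A_def)
  have "det A \<noteq> 0"
  proof
    assume "det A = 0"
    then obtain v where v: "v \<in> carrier_vec t" "v \<noteq> 0\<^sub>v t" "A *\<^sub>v v = 0\<^sub>v t"
      using det_0_iff_vec_prod_zero[OF A] by blast
    have "(\<Sum>i<t. (vec_index v i)\<^sup>2) \<le> (\<Sum>i<t. \<Sum>j<t. vec_index v i * vec_index v j * S i j)"
      by (rule coercive)
    also have "\<dots> = (\<Sum>i<t. vec_index v i * vec_index (A *\<^sub>v v) i)"
      by (intro sum.cong refl) (simp add: Av v(1) sum_distrib_left mult_ac del: index_mult_mat_vec)
    also have "\<dots> = 0"
      by (simp add: v(3))
    finally have "(\<Sum>i<t. (vec_index v i)\<^sup>2) = 0"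
      by (intro antisym sum_nonneg) auto
    then have "\<forall>i<t. vec_index v i = 0"
      by (subst (asm) sum_nonneg_eq_0_iff) auto
    then have "v = 0\<^sub>v t"
      using v(1) by (intro eq_vecI) auto
    with v(2) show False ..
  qed
  note inv = mat_inv_right[OF A this]
  define k where "k = mat_inv A *\<^sub>v Matrix.vec t b"
  have k: "k \<in> carrier_vec t"
    using inv(1) by (simp add: k_def)
  have "A *\<^sub>v k = Matrix.vec t b"
    unfolding k_def using assoc_mult_mat_vec[OF A inv(1), of "Matrix.vec t b"] inv(2)
    by simp
  then have "(\<Sum>j<t. S i j * vec_index k j) = b i" if "i < t" for i
    using Av[OF k that] that by simp
  then show ?thesis
    by blast
qed

text \<open>The cost is a sum over rows, and row t of a strictly lower triangular matrix involves
  only the observations before t. So each row is an independent least-squares problem, solved by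
  making its error orthogonal to the past observations.\<close>

lemma ex1_optimal_causal_estimator:
  fixes X Y :: "nat \<Rightarrow> 'a \<Rightarrow> real"
  assumes X: "\<And>t. square_integrable M (X t)" and Y: "\<And>t. square_integrable M (Y t)"
    and coercive: "\<And>k. (\<Sum>j<T + 1. (k j)\<^sup>2) \<le> (\<integral>\<omega>. (\<Sum>j<T + 1. k j * Y j \<omega>)\<^sup>2 \<partial>M)"
  shows "\<exists>!K. is_arg_min (\<lambda>K. \<integral>\<omega>. (\<Sum>t<T + 1. (X t \<omega> - (\<Sum>j<T + 1. K $$ (t, j) * Y j \<omega>))\<^sup>2) \<partial>M)
    (strictly_lower T) K"
proof -
  define n where "n = T + 1"
  define e where "e K t \<omega> = X t \<omega> - (\<Sum>j<n. K $$ (t, j) * Y j \<omega>)" for K t \<omega>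
  define J where "J K = (\<integral>\<omega>. (\<Sum>t<n. (e K t \<omega>)\<^sup>2) \<partial>M)" for K
  have sq_lin: "square_integrable M (\<lambda>\<omega>. \<Sum>j\<in>I. k j * Y j \<omega>)" for k I
    by (intro square_integrable_sum square_integrable_cmult Y)
  have sq_e: "square_integrable M (e K t)" for K t
    unfolding e_def by (intro square_integrable_diff X sq_lin)
  have "\<exists>k. \<forall>i<t. (\<Sum>j<t. (\<integral>\<omega>. Y i \<omega> * Y j \<omega> \<partial>M) * k j) = (\<integral>\<omega>. Y i \<omega> * X t \<omega> \<partial>M)" if "t < n" for t
  proof (rule coercive_linear_system)
    fix x :: "nat \<Rightarrow> real"
    \<comment> \<open>Padding with zeros restricts coercivity on the whole horizon to the leading t
      by t block.\<close>
    define k where "k j = (if j < t then x j else 0)" for j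
    have "(\<Sum>i<t. (x i)\<^sup>2) = (\<Sum>j<n. (k j)\<^sup>2)"
      using that by (intro sum.mono_neutral_cong_left) (auto simp: k_def)
    also have "\<dots> \<le> (\<integral>\<omega>. (\<Sum>j<n. k j * Y j \<omega>)\<^sup>2 \<partial>M)"
      using coercive by (simp add: n_def)
    also have "(\<lambda>\<omega>. \<Sum>j<n. k j * Y j \<omega>) = (\<lambda>\<omega>. \<Sum>j<t. x j * Y j \<omega>)"
      using that by (intro ext sum.mono_neutral_cong_right) (auto simp: k_def)
    also have "(\<integral>\<omega>. (\<Sum>j<t. x j * Y j \<omega>)\<^sup>2 \<partial>M) =
        (\<Sum>i<t. \<Sum>j<t. x i * x j * (\<integral>\<omega>. Y i \<omega> * Y j \<omega> \<partial>M))"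
      unfolding power2_eq_square by (rule integral_sum_mult_sum) (rule Y)+
    finally show "(\<Sum>i<t. (x i)\<^sup>2) \<le> (\<Sum>i<t. \<Sum>j<t. x i * x j * (\<integral>\<omega>. Y i \<omega> * Y j \<omega> \<partial>M))" .
  qed
  then obtain k where k: "\<And>t i. t < n \<Longrightarrow> i < t \<Longrightarrow>
      (\<Sum>j<t. (\<integral>\<omega>. Y i \<omega> * Y j \<omega> \<partial>M) * k t j) = (\<integral>\<omega>. Y i \<omega> * X t \<omega> \<partial>M)"
    by metis
  define K where "K = Matrix.mat n n (\<lambda>(t, j). if j < t then k t j else 0)"
  have K: "strictly_lower T K"
    by (auto simp: strictly_lower_def K_def n_def)
  have orth: "(\<integral>\<omega>. e K t \<omega> * Y i \<omega> \<partial>M) = 0" if "t < n" "i < t" for t i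
  proof -
    have "(\<Sum>j<n. K $$ (t, j) * Y j \<omega>) = (\<Sum>j<t. k t j * Y j \<omega>)" for \<omega>
      using that by (intro sum.mono_neutral_cong_right) (auto simp: K_def)
    then have "(\<integral>\<omega>. e K t \<omega> * Y i \<omega> \<partial>M) = (\<integral>\<omega>. Y i \<omega> * X t \<omega> - Y i \<omega> * (\<Sum>j<t. k t j * Y j \<omega>) \<partial>M)"
      by (simp add: e_def algebra_simps)
    also have "\<dots> = (\<integral>\<omega>. Y i \<omega> * X t \<omega> \<partial>M) - (\<integral>\<omega>. Y i \<omega> * (\<Sum>j<t. k t j * Y j \<omega>) \<partial>M)"
      by (intro Bochner_Integration.integral_diff integrable_mult_square_integrable X Y sq_lin)
    also have "(\<integral>\<omega>. Y i \<omega> * (\<Sum>j<t. k t j * Y j \<omega>) \<partial>M) = (\<Sum>j<t. k t j * (\<integral>\<omega>. Y i \<omega> * Y j \<omega> \<partial>M))"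
      by (rule integral_mult_sum_right) (rule Y)+
    also have "\<dots> = (\<integral>\<omega>. Y i \<omega> * X t \<omega> \<partial>M)"
      using k[OF that] by (simp add: mult.commute)
    finally show ?thesis
      by simp
  qed
  have J_split: "J K' = (\<Sum>t<n. \<integral>\<omega>. (e K' t \<omega>)\<^sup>2 \<partial>M)" for K'
    unfolding J_def using sq_e by (intro Bochner_Integration.integral_sum) (auto simp: square_integrable_def)
  \<comment> \<open>By Pythagoras the excess cost is the second moment of the difference of the
    estimates, which coercivity bounds below by the squared distance of the matrices. This gives
    minimality and uniqueness at once.\<close>
  have J_ge: "J K' \<ge> J K + (\<Sum>t<n. \<Sum>j<n. (K $$ (t, j) - K' $$ (t, j))\<^sup>2)" if K': "strictly_lower T K'" for K'
    unfolding J_split sum.distrib[symmetric]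
  proof (intro sum_mono)
    fix t assume "t \<in> {..<n}"
    then have t: "t < n" by simp
    define d where "d j = K $$ (t, j) - K' $$ (t, j)" for j
    define D where "D \<omega> = (\<Sum>j<n. d j * Y j \<omega>)" for \<omega>
    have sq_D: "square_integrable M D"
      unfolding D_def by (rule sq_lin)
    have "e K' t \<omega> = e K t \<omega> + D \<omega>" for \<omega>
      by (simp add: e_def D_def d_def left_diff_distrib sum_subtractf)
    then have "(\<integral>\<omega>. (e K' t \<omega>)\<^sup>2 \<partial>M) = (\<integral>\<omega>. (e K t \<omega>)\<^sup>2 + (D \<omega>)\<^sup>2 + 2 * (e K t \<omega> * D \<omega>) \<partial>M)"
      by (simp add: power2_sum mult.assoc)
    also have "\<dots> = (\<integral>\<omega>. (e K t \<omega>)\<^sup>2 \<partial>M) + (\<integral>\<omega>. (D \<omega>)\<^sup>2 \<partial>M) + 2 * (\<integral>\<omega>. e K t \<omega> * D \<omega> \<partial>M)"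
      using sq_e[of K t] sq_D integrable_mult_square_integrable[OF sq_e[of K t] sq_D]
      by (simp add: square_integrable_def)
    also have "(\<integral>\<omega>. e K t \<omega> * D \<omega> \<partial>M) = (\<Sum>j<n. d j * (\<integral>\<omega>. e K t \<omega> * Y j \<omega> \<partial>M))"
      unfolding D_def by (rule integral_mult_sum_right[OF sq_e Y])
    \<comment> \<open>The cross term: for j < t the error is orthogonal to observation j, and for j
      >= t both matrices have entry 0.\<close>
    also have "\<dots> = 0"
    proof (intro sum.neutral ballI)
      fix j assume "j \<in> {..<n}"
      then show "d j * (\<integral>\<omega>. e K t \<omega> * Y j \<omega> \<partial>M) = 0"
        using orth[OF t] K K' t by (cases "j < t") (auto simp: d_def strictly_lower_def n_def)
    qed
    finally show "(\<integral>\<omega>. (e K t \<omega>)\<^sup>2 \<partial>M) + (\<Sum>j<n. (K $$ (t, j) - K' $$ (t, j))\<^sup>2) \<le> (\<integral>\<omega>. (e K' t \<omega>)\<^sup>2 \<partial>M)"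
      using coercive[of d] by (simp add: D_def d_def n_def)
  qed
  have nonneg: "(\<Sum>t<n. \<Sum>j<n. (K $$ (t, j) - K' $$ (t, j))\<^sup>2) \<ge> 0" for K'
    by (intro sum_nonneg) auto
  have "\<exists>!K. is_arg_min J (strictly_lower T) K"
  proof (rule ex1I)
    show "is_arg_min J (strictly_lower T) K"
      unfolding is_arg_min_linorder using K J_ge nonneg by (meson add_increasing2 order_refl order_trans le_add_same_cancel1)
    fix K' assume K': "is_arg_min J (strictly_lower T) K'"
    then have L: "strictly_lower T K'" and le: "J K' \<le> J K"
      using K by (auto simp: is_arg_min_linorder)
    from J_ge[OF L] le nonneg[of K'] have "(\<Sum>t<n. \<Sum>j<n. (K $$ (t, j) - K' $$ (t, j))\<^sup>2) = 0"
      by linarith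
    then have "\<forall>t<n. \<forall>j<n. K $$ (t, j) = K' $$ (t, j)"
      by (simp add: sum_nonneg_eq_0_iff sum_nonneg)
    then show "K' = K"
      using K L by (intro eq_matI) (auto simp: strictly_lower_def n_def)
  qed
  then show ?thesis
    unfolding J_def e_def n_def .
qed

section \<open>Invariance of mutual information\<close>

lemma absolutely_continuous_distr:
  assumes "absolutely_continuous M N" "f \<in> measurable M M'" "sets N = sets M"
  shows "absolutely_continuous (distr M M' f) (distr N M' f)"
proof -
  have sp: "space N = space M"
    using assms(3) by (rule sets_eq_imp_space_eq)
  have f: "f \<in> measurable N M'"
    using assms(2) by (simp only: measurable_cong_sets[OF assms(3) refl])
  show ?thesis
    unfolding absolutely_continuous_def
  proof
    fix X assume X: "X \<in> null_sets (distr M M' f)"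
    then have "f -` X \<inter> space M \<in> null_sets M" "X \<in> sets M'"
      using assms(2) by (auto simp: null_sets_distr_iff)
    then have "f -` X \<inter> space N \<in> null_sets N"
      using assms(1) sp by (auto simp: absolutely_continuous_def)
    then show "X \<in> null_sets (distr N M' f)"
      using f \<open>X \<in> sets M'\<close> by (simp add: null_sets_distr_iff)
  qed
qed

text \<open>A default value: without a density \<open>RN_deriv\<close> is the zero function, and the
  logarithm of 0 is 0. Mathematically the divergence is infinite here, so invariance has to treat
  this case separately.\<close>

lemma KL_divergence_eq_0_if_not_absolutely_continuous:
  assumes "\<not> absolutely_continuous M N"
  shows "KL_divergence b M N = 0"
proof -
  have "RN_deriv M N = (\<lambda>_. 0)"
    using assms absolutely_continuousI_density unfolding RN_deriv_def by metis
  then show ?thesis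
    by (simp add: KL_divergence_def entropy_density_def comp_def log_def)
qed

text \<open>Pushing forward along f and back along g recovers both measures, so absolute continuity
  holds on both sides or on neither. If it holds, the densities correspond under f; if not, both
  divergences take the default value.\<close>

lemma KL_divergence_distr_left_inverse:
  assumes M: "sigma_finite_measure M" and N: "sets N = sets M"
    and f: "f \<in> measurable M M'" and g: "g \<in> measurable M' M"
    and gf: "\<And>x. x \<in> space M \<Longrightarrow> g (f x) = x"
  shows "KL_divergence b (distr M M' f) (distr N M' f) = KL_divergence b M N"
proof -
  interpret M: sigma_finite_measure M by fact
  have sp: "space N = space M"
    using N by (rule sets_eq_imp_space_eq)
  have fN: "f \<in> measurable N M'"
    using f by (simp only: measurable_cong_sets[OF N refl])
  have gN: "g \<in> measurable M' N"
    using g by (simp only: measurable_cong_sets[OF refl N])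
  have distr_inv: "distr (distr M M' f) M g = M" "distr (distr N M' f) M g = N"
  proof -
    have "distr (distr M M' f) M g = distr M M (g \<circ> f)"
      using f g by (simp add: distr_distr)
    also have "\<dots> = M"
      by (subst distr_cong[of M M M M _ "\<lambda>x. x"]) (auto simp: gf distr_id2)
    finally show "distr (distr M M' f) M g = M" .
    have "distr (distr N M' f) M g = distr N M (g \<circ> f)"
      using fN g by (simp add: distr_distr)
    also have "\<dots> = N"
      using N by (subst distr_cong[of N N M N _ "\<lambda>x. x"]) (auto simp: gf sp distr_id2)
    finally show "distr (distr N M' f) M g = N" .
  qed
  show ?thesis
  proof (cases "absolutely_continuous M N")
    case True
    have ac': "absolutely_continuous (distr M M' f) (distr N M' f)"
      by (rule absolutely_continuous_distr[OF True f N])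
    have "AE x in M. RN_deriv (distr M M' f) (distr N M' f) (f x) = RN_deriv M N x"
      using gf by (intro M.RN_deriv_distr[OF f g _ ac' N]) auto
    \<comment> \<open>The densities agree almost everywhere with respect to M, while the divergence
      integrates with respect to N; absolute continuity transfers the null set.\<close>
    then have ae: "AE x in N. RN_deriv (distr M M' f) (distr N M' f) (f x) = RN_deriv M N x"
      using absolutely_continuous_AE[OF N True] by simp
    have "KL_divergence b (distr M M' f) (distr N M' f) =
        (\<integral>x. entropy_density b (distr M M' f) (distr N M' f) (f x) \<partial>N)"
      unfolding KL_divergence_def
      using measurable_entropy_density[of b "distr M M' f" "distr N M' f"]
      by (intro integral_distr fN) simp
    also have "\<dots> = (\<integral>x. entropy_density b M N x \<partial>N)"
    proof (rule integral_cong_AE)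
      show "(\<lambda>x. entropy_density b (distr M M' f) (distr N M' f) (f x)) \<in> borel_measurable N"
        using measurable_entropy_density[of b "distr M M' f" "distr N M' f"]
        by (intro measurable_compose[OF fN]) simp
      show "entropy_density b M N \<in> borel_measurable N"
        using measurable_entropy_density[of b M N] by (simp only: measurable_cong_sets[OF N refl])
      show "AE x in N. entropy_density b (distr M M' f) (distr N M' f) (f x) = entropy_density b M N x"
        using ae by eventually_elim (simp add: entropy_density_def)
    qed
    finally show ?thesis
      by (simp add: KL_divergence_def)
  next
    case False
    have "\<not> absolutely_continuous (distr M M' f) (distr N M' f)"
    proof
      assume "absolutely_continuous (distr M M' f) (distr N M' f)"
      from absolutely_continuous_distr[OF this, of g M] g have "absolutely_continuous M N"
        by (simp add: distr_inv)
      with False show False ..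
    qed
    with False show ?thesis
      by (simp add: KL_divergence_eq_0_if_not_absolutely_continuous)
  qed
qed

text \<open>The map that leaves the first component alone and applies f to the second carries both
  the joint law and the product of the marginals to those of the transformed pair, and it has a left
  inverse as well.\<close>

lemma (in prob_space) mutual_information_left_inverse:
  fixes S :: "'b measure" and T :: "'c measure" and T' :: "'d measure"
  assumes X: "X \<in> measurable M S" and Y: "Y \<in> measurable M T"
    and f: "f \<in> measurable T T'" and g: "g \<in> measurable T' T"
    and gf: "\<And>x. x \<in> space T \<Longrightarrow> g (f x) = x"
  shows "mutual_information b S T' X (\<lambda>\<omega>. f (Y \<omega>)) = mutual_information b S T X Y"
proof -
  define h where "h = (\<lambda>(x :: 'b, y). (x, f y))" 
  define h' where "h' = (\<lambda>(x :: 'b, y). (x, g y))"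
  let ?P = "distr M S X \<Otimes>\<^sub>M distr M T Y" and ?J = "distr M (S \<Otimes>\<^sub>M T) (\<lambda>\<omega>. (X \<omega>, Y \<omega>))"
  have fY: "(\<lambda>\<omega>. f (Y \<omega>)) \<in> measurable M T'"
    using Y f by measurable
  interpret pX: prob_space "distr M S X" by (rule prob_space_distr[OF X])
  interpret pY: prob_space "distr M T Y" by (rule prob_space_distr[OF Y])
  interpret pfY: prob_space "distr M T' (\<lambda>\<omega>. f (Y \<omega>))" by (rule prob_space_distr[OF fY])
  have s: "sets ?P = sets (S \<Otimes>\<^sub>M T)"
    by (intro sets_pair_measure_cong) auto
  have hm: "h \<in> measurable (S \<Otimes>\<^sub>M T) (S \<Otimes>\<^sub>M T')"
    using f unfolding h_def by measurable
  have hm': "h' \<in> measurable (S \<Otimes>\<^sub>M T') (S \<Otimes>\<^sub>M T)"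
    using g unfolding h'_def by measurable
  have eY: "distr M T' (\<lambda>\<omega>. f (Y \<omega>)) = distr (distr M T Y) T' f"
    using f Y by (simp add: distr_distr comp_def)
  have "distr M S X = distr (distr M S X) S (\<lambda>x. x)"
    by (simp add: distr_id2)
  then have "distr M S X \<Otimes>\<^sub>M distr M T' (\<lambda>\<omega>. f (Y \<omega>))
      = distr (distr M S X) S (\<lambda>x. x) \<Otimes>\<^sub>M distr (distr M T Y) T' f"
    using eY by simp
  also have "\<dots> = distr ?P (S \<Otimes>\<^sub>M T') (\<lambda>(x, y). (x, f y))"
    using f pfY.sigma_finite_measure_axioms eY by (intro pair_measure_distr) auto
  finally have e1: "distr M S X \<Otimes>\<^sub>M distr M T' (\<lambda>\<omega>. f (Y \<omega>)) = distr ?P (S \<Otimes>\<^sub>M T') h"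
    by (simp add: h_def)
  have e2: "distr M (S \<Otimes>\<^sub>M T') (\<lambda>\<omega>. (X \<omega>, f (Y \<omega>))) = distr ?J (S \<Otimes>\<^sub>M T') h"
    by (subst distr_distr[OF hm measurable_Pair[OF X Y]]) (simp add: comp_def h_def)
  have "KL_divergence b (distr ?P (S \<Otimes>\<^sub>M T') h) (distr ?J (S \<Otimes>\<^sub>M T') h) = KL_divergence b ?P ?J"
  proof (rule KL_divergence_distr_left_inverse)
    show "sigma_finite_measure ?P"
      by (intro prob_space_imp_sigma_finite prob_space_pair pX.prob_space_axioms pY.prob_space_axioms)
    show "sets ?J = sets ?P" using s by simp
    show "h \<in> measurable ?P (S \<Otimes>\<^sub>M T')" using hm by (simp only: measurable_cong_sets[OF s refl])
    show "h' \<in> measurable (S \<Otimes>\<^sub>M T') ?P" using hm' by (simp only: measurable_cong_sets[OF refl s])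
    show "h' (h x) = x" if "x \<in> space ?P" for x
      using that gf by (auto simp: h_def h'_def space_pair_measure)
  qed
  then show ?thesis
    by (simp add: mutual_information_def e1 e2)
qed

section \<open>Moments of the signals\<close>

lemma (in prob_space) std_normal_moments:
  assumes D: "distributed M lborel X std_normal_density"
  shows "square_integrable M X" and "expectation X = 0" and "expectation (\<lambda>\<omega>. (X \<omega>)\<^sup>2) = 1"
proof -
  have X: "X \<in> borel_measurable M"
    using distributed_measurable[OF D] by simp
  have "integrable M (\<lambda>\<omega>. (X \<omega>)\<^sup>2)"
    using distributed_integrable[OF D, of "\<lambda>x. x\<^sup>2"] integrable_std_normal_moment[of 2] by simp
  with X show "square_integrable M X"
    by (simp add: square_integrable_def)
  show "expectation X = 0"
    using distributed_integral[OF D, of "\<lambda>x. x"] integral_std_normal_moment_odd[of 0] by simp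
  show "expectation (\<lambda>\<omega>. (X \<omega>)\<^sup>2) = 1"
    using distributed_integral[OF D, of "\<lambda>x. x\<^sup>2"] integral_std_normal_moment_even[of 1] by simp
qed

lemma (in prob_space) square_integrable_imp_integrable:
  assumes "square_integrable M X"
  shows "integrable M X"
  using integrable_mult_square_integrable[OF assms, of "\<lambda>_. 1"]
  by (simp add: square_integrable_def)

lemma (in prob_space) white_gaussian_noise_moments:
  assumes "white_gaussian_noise M N"
  shows "square_integrable M (N i)" and "expectation (\<lambda>\<omega>. N i \<omega> * N j \<omega>) = (if i = j then 1 else 0)"
proof -
  have D: "distributed M lborel (N t) std_normal_density" for t
    using assms by (simp add: white_gaussian_noise_def)
  note m = std_normal_moments[OF D]
  show "square_integrable M (N i)"
    by (rule m(1))
  show "expectation (\<lambda>\<omega>. N i \<omega> * N j \<omega>) = (if i = j then 1 else 0)"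
  proof (cases "i = j")
    case True
    then show ?thesis
      using m(3) by (simp add: power2_eq_square)
  next
    case False
    have "indep_vars (\<lambda>_. borel) N (insert i {j})"
      using assms by (auto simp: white_gaussian_noise_def intro: indep_vars_subset)
    \<comment> \<open>Independence of one variable from a sum over the others, used with the single
      other index \<open>j\<close>, gives pairwise independence.\<close>
    from indep_vars_sum[OF _ _ this] have "indep_var borel (N i) borel (N j)"
      using False by simp
    then show ?thesis
      using False m(2) square_integrable_imp_integrable[OF m(1)]
      by (simp add: indep_var_lebesgue_integral)
  qed
qed

lemma (in prob_space) expectation_message_noise:
  assumes W: "standard_gaussian_message M n W" and N: "white_gaussian_noise M N"
    and ind: "indep_var (real_space n) (block n W) (real_space T) (block T N)"
    and ij: "i \<le> n" "j \<le> T"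
  shows "expectation (\<lambda>\<omega>. W i \<omega> * N j \<omega>) = 0"
proof -
  have "indep_var borel ((\<lambda>x. x i) \<circ> block n W) borel ((\<lambda>x. x j) \<circ> block T N)"
    using ij by (intro indep_var_compose[OF ind] measurable_component_singleton) auto
  moreover have "(\<lambda>x. x i) \<circ> block n W = W i" "(\<lambda>x. x j) \<circ> block T N = N j"
    using ij by (auto simp: block_def)
  ultimately have "indep_var borel (W i) borel (N j)"
    by simp
  moreover have "distributed M lborel (W i) std_normal_density" "distributed M lborel (N j) std_normal_density"
    using W N ij by (auto simp: standard_gaussian_message_def white_gaussian_noise_def)
  ultimately show ?thesis
    using std_normal_moments square_integrable_imp_integrable by (simp add: indep_var_lebesgue_integral)
qed

text \<open>With the cross terms gone, the noise contributes exactly the sum of squares and the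
  signal something nonnegative.\<close>

lemma coercive_signal_plus_noise:
  fixes n :: nat
  assumes Z: "\<And>j. j < n \<Longrightarrow> square_integrable M (Z j)" and N: "\<And>j. j < n \<Longrightarrow> square_integrable M (N j)"
    and ZN: "\<And>i j. i < n \<Longrightarrow> j < n \<Longrightarrow> (\<integral>\<omega>. Z i \<omega> * N j \<omega> \<partial>M) = 0"
    and NN: "\<And>i j. i < n \<Longrightarrow> j < n \<Longrightarrow> (\<integral>\<omega>. N i \<omega> * N j \<omega> \<partial>M) = (if i = j then 1 else 0)"
  shows "(\<Sum>j<n. (k j)\<^sup>2) \<le> (\<integral>\<omega>. (\<Sum>j<n. k j * (Z j \<omega> + N j \<omega>))\<^sup>2 \<partial>M)"
proof -
  define X where "X \<omega> = (\<Sum>j<n. k j * Z j \<omega>)" for \<omega>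
  define Y where "Y \<omega> = (\<Sum>j<n. k j * N j \<omega>)" for \<omega>
  have X: "square_integrable M X" and Y: "square_integrable M Y"
    unfolding X_def Y_def using Z N by (auto intro!: square_integrable_sum square_integrable_cmult)
  have XY: "(\<integral>\<omega>. X \<omega> * Y \<omega> \<partial>M) = 0"
    unfolding X_def Y_def using Z N ZN by (subst integral_sum_mult_sum) auto
  have "(\<integral>\<omega>. (Y \<omega>)\<^sup>2 \<partial>M) = (\<Sum>i<n. \<Sum>j<n. k i * k j * (\<integral>\<omega>. N i \<omega> * N j \<omega> \<partial>M))"
    unfolding Y_def power2_eq_square using N by (subst integral_sum_mult_sum) auto
  also have "\<dots> = (\<Sum>i<n. \<Sum>j<n. if i = j then k i * k j else 0)"
    using NN by (intro sum.cong refl) auto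
  also have "\<dots> = (\<Sum>j<n. (k j)\<^sup>2)"
    by (simp add: power2_eq_square)
  finally have YY: "(\<integral>\<omega>. (Y \<omega>)\<^sup>2 \<partial>M) = (\<Sum>j<n. (k j)\<^sup>2)" .
  have "(\<integral>\<omega>. (\<Sum>j<n. k j * (Z j \<omega> + N j \<omega>))\<^sup>2 \<partial>M) = (\<integral>\<omega>. (X \<omega>)\<^sup>2 + (Y \<omega>)\<^sup>2 + 2 * (X \<omega> * Y \<omega>) \<partial>M)"
    by (simp add: X_def Y_def distrib_left sum.distrib power2_sum mult.assoc)
  also have "\<dots> = (\<integral>\<omega>. (X \<omega>)\<^sup>2 \<partial>M) + (\<integral>\<omega>. (Y \<omega>)\<^sup>2 \<partial>M) + 2 * (\<integral>\<omega>. X \<omega> * Y \<omega> \<partial>M)"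
    using X Y integrable_mult_square_integrable[OF X Y] by (simp add: square_integrable_def)
  finally show ?thesis
    using XY YY by (simp add: integral_nonneg)
qed

section \<open>Linear dependence on the message, and linear maps on output sequences\<close>

lemma encoder_state_linear:
  assumes "A \<in> carrier_mat d d"
  shows "\<exists>B\<in>carrier_mat d d. \<forall>w\<in>carrier_vec d. encoder_state A w t = B *\<^sub>v w"
proof (induction t)
  case 0
  show ?case
    by (intro bexI[of _ "1\<^sub>m d"]) auto
next
  case (Suc t)
  then obtain B where B: "B \<in> carrier_mat d d" "\<forall>w\<in>carrier_vec d. encoder_state A w t = B *\<^sub>v w"
    by blast
  then show ?case
    using assms by (intro bexI[of _ "A * B"]) (auto simp: assoc_mult_mat_vec[of _ d d _ d])
qed

lemma source_signal_linear:
  assumes A: "A \<in> carrier_mat (n + 1) (n + 1)" and C: "C \<in> carrier_mat 1 (n + 1)"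
  shows "\<exists>c. \<forall>\<omega>. source_signal n W A C t \<omega> = (\<Sum>i<n + 1. c i * W i \<omega>)"
proof -
  obtain B where B: "B \<in> carrier_mat (n + 1) (n + 1)"
    and st: "\<And>w. w \<in> carrier_vec (n + 1) \<Longrightarrow> encoder_state A w t = B *\<^sub>v w"
    using encoder_state_linear[OF A] by blast
  have "source_signal n W A C t \<omega> = (\<Sum>i<n + 1. (C * B) $$ (0, i) * W i \<omega>)" for \<omega>
  proof -
    have "source_signal n W A C t \<omega> = vec_index (C * B *\<^sub>v Matrix.vec (n + 1) (\<lambda>i. W i \<omega>)) 0"
      unfolding source_signal_def encoder_output_def
      by (subst st, simp, subst assoc_mult_mat_vec[OF C B]) auto
    also have "\<dots> = (\<Sum>i<n + 1. (C * B) $$ (0, i) * vec_index (Matrix.vec (n + 1) (\<lambda>i. W i \<omega>)) i)"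
      by (rule index_mult_mat_vec_sum[OF mult_carrier_mat[OF C B]]) auto
    finally show ?thesis
      by simp
  qed
  then show ?thesis
    by (intro exI[of _ "\<lambda>i. (C * B) $$ (0, i)"]) simp
qed

text \<open>Matrix multiplication on the product space in which \<open>block\<close> takes its
  values. The restriction to \<open>{..T}\<close> keeps results extensional, so that a matrix
  inverse gives an exact inverse on that space.\<close>

definition linear_map :: "nat \<Rightarrow> real mat \<Rightarrow> (nat \<Rightarrow> real) \<Rightarrow> nat \<Rightarrow> real" where
  "linear_map T X x = (\<lambda>i\<in>{..T}. \<Sum>j<T + 1. X $$ (i, j) * x j)"

lemma measurable_linear_map: "linear_map T X \<in> measurable (real_space T) (real_space T)"
  unfolding linear_map_def
  by (intro measurable_restrict borel_measurable_sum borel_measurable_times borel_measurable_const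
      measurable_component_singleton) auto

lemma linear_map_inverse:
  assumes X: "X \<in> carrier_mat (T + 1) (T + 1)" and Y: "Y \<in> carrier_mat (T + 1) (T + 1)"
    and YX: "Y * X = 1\<^sub>m (T + 1)" and x: "x \<in> space (real_space T)"
  shows "linear_map T Y (linear_map T X x) = x"
proof
  fix i
  show "linear_map T Y (linear_map T X x) i = x i"
  proof (cases "i \<le> T")
    case True
    have "linear_map T Y (linear_map T X x) i = (\<Sum>j<T + 1. Y $$ (i, j) * (\<Sum>k<T + 1. X $$ (j, k) * x k))"
      using True by (simp add: linear_map_def)
    also have "\<dots> = (\<Sum>j<T + 1. \<Sum>k<T + 1. Y $$ (i, j) * X $$ (j, k) * x k)"
      by (simp only: sum_distrib_left mult.assoc)
    also have "\<dots> = (\<Sum>k<T + 1. \<Sum>j<T + 1. Y $$ (i, j) * X $$ (j, k) * x k)"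
      by (rule sum.swap)
    also have "\<dots> = (\<Sum>k<T + 1. (Y * X) $$ (i, k) * x k)"
      using True
      by (intro sum.cong refl, subst index_mult_mat_sum[OF Y X]) (auto simp only: sum_distrib_right lessThan_iff)
    also have "\<dots> = (\<Sum>k<T + 1. if i = k then x k else 0)"
      unfolding YX using True by (intro sum.cong) auto
    also have "\<dots> = x i"
      using True by simp
    finally show ?thesis .
  next
    \<comment> \<open>Outside the horizon both sides are \<open>undefined\<close>, because points of
      the product space are extensional.\<close>
    case False
    then show ?thesis
      using x by (auto simp: linear_map_def space_PiM PiE_def extensional_def)
  qed
qed

text \<open>An involution of \<open>S\<close> that turns one objective into the other exchanges
  their minimisers. Uniqueness then pins down the two values chosen by
  \<open>arg_min\<close>.\<close>

lemma ex1_is_arg_min_involution: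
  fixes f g :: "'a \<Rightarrow> 'b :: linorder"
  assumes ex1: "\<exists>!x. is_arg_min g S x"
    and inv: "\<And>x. S x \<Longrightarrow> S (h x)" "\<And>x. S x \<Longrightarrow> h (h x) = x" and fg: "\<And>x. S x \<Longrightarrow> f x = g (h x)"
  shows "\<exists>!x. is_arg_min f S x" and "arg_min f S = h (arg_min g S)"
proof -
  have iff: "is_arg_min f S x \<longleftrightarrow> S x \<and> is_arg_min g S (h x)" for x
    unfolding is_arg_min_linorder using inv fg by metis
  obtain k where k: "is_arg_min g S k" and uniq: "\<And>x. is_arg_min g S x \<Longrightarrow> x = k"
    using ex1 by blast
  have "S k"
    using k by (simp add: is_arg_min_def)
  then have fk: "is_arg_min f S (h k)"
    using k inv iff by simp
  have funiq: "x = h k" if "is_arg_min f S x" for x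
    using that iff inv(2) uniq by metis
  show "\<exists>!x. is_arg_min f S x"
    using fk funiq by blast
  have "arg_min f S = h k"
    unfolding arg_min_def using fk funiq by (rule some_equality)
  moreover have "arg_min g S = k"
    unfolding arg_min_def using k uniq by (rule some_equality)
  ultimately show "arg_min f S = h (arg_min g S)"
    by simp
qed

section \<open>Power, rate and the optimal feedback generator\<close>

lemma observation_block_eq:
  assumes "mat_inv (channel_mat T num den) = P"
  shows "observation_block num den T n W N A C \<omega> =
    P *\<^sub>v Matrix.vec (T + 1) (\<lambda>t. source_signal n W A C t \<omega>) + Matrix.vec (T + 1) (\<lambda>t. N t \<omega>)"
  by (simp add: observation_block_def source_block_def assms)

text \<open>The identity holds for each outcome before expectations are taken: the vector of channel
  inputs is the estimation error.\<close>

lemma average_power_eq_estimation_error: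
  assumes F: "F \<in> carrier_mat m m" and G: "G \<in> carrier_mat m 1" and H: "H \<in> carrier_mat 1 m"
    and P: "mat_inv (channel_mat T num den) = toeplitz T (markov_parameter F G H 1)"
    and L: "strictly_lower T L"
  shows "average_power M F G H T n W N A C L =
    estimation_error M num den T n W N A C (feedback_dual T (mat_inv (channel_mat T num den)) L)"
proof -
  have "(\<Sum>t\<le>T. (input_signal F G H n W N A C L t \<omega>)\<^sup>2) =
      (let e = source_block T n W A C \<omega> - feedback_dual T (mat_inv (channel_mat T num den)) L *\<^sub>v
          observation_block num den T n W N A C \<omega>
       in scalar_prod e e)" for \<omega>
  proof -
    have "source_block T n W A C \<omega> - feedback_dual T (mat_inv (channel_mat T num den)) L *\<^sub>v
        observation_block num den T n W N A C \<omega> =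
        Matrix.vec (T + 1) (\<lambda>t. input_signal F G H n W N A C L t \<omega>)"
      unfolding observation_block_eq[OF refl] source_block_def P input_signal_def
      by (rule closed_loop(2)[OF F G H L, symmetric])
    then show ?thesis
      by (simp add: scalar_prod_def power2_eq_square atLeast0LessThan lessThan_Suc_atMost)
  qed
  then show ?thesis
    by (simp add: average_power_def estimation_error_def)
qed

text \<open>Both claims rest on splitting the observation into a part \<open>Z\<close> that is
  linear in the message, hence uncorrelated with the noise, and the noise itself.\<close>

lemma (in prob_space)
  assumes W: "standard_gaussian_message M n W" and N: "white_gaussian_noise M N"
    and ind: "indep_var (real_space n) (block n W) (real_space T) (block T N)"
    and A: "A \<in> carrier_mat (n + 1) (n + 1)" and C: "C \<in> carrier_mat 1 (n + 1)"
    and P: "mat_inv (channel_mat T num den) \<in> carrier_mat (T + 1) (T + 1)"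
  shows square_integrable_observation:
      "t \<le> T \<Longrightarrow> square_integrable M (\<lambda>\<omega>. vec_index (observation_block num den T n W N A C \<omega>) t)"
    and ex1_optimal_estimator:
      "\<exists>!K. is_arg_min (estimation_error M num den T n W N A C) (strictly_lower T) K"
proof -
  define P where "P = mat_inv (channel_mat T num den)"
  define X where "X t \<omega> = source_signal n W A C t \<omega>" for t \<omega>
  define Z where "Z t \<omega> = (\<Sum>k<T + 1. P $$ (t, k) * X k \<omega>)" for t \<omega>
  have Wsq: "square_integrable M (W i)" if "i < n + 1" for i
    using W that std_normal_moments(1) by (simp add: standard_gaussian_message_def)
  note Nsq = white_gaussian_noise_moments(1)[OF N]
  obtain c where c: "\<And>t \<omega>. X t \<omega> = (\<Sum>i<n + 1. c t i * W i \<omega>)"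
    unfolding X_def using source_signal_linear[OF A C] by metis
  have Xsq: "square_integrable M (X t)" for t
    unfolding c[abs_def] by (intro square_integrable_sum square_integrable_cmult Wsq) simp
  have XN: "expectation (\<lambda>\<omega>. X t \<omega> * N j \<omega>) = 0" if "j < T + 1" for t j
  proof -
    have "expectation (\<lambda>\<omega>. X t \<omega> * N j \<omega>) = expectation (\<lambda>\<omega>. N j \<omega> * (\<Sum>i<n + 1. c t i * W i \<omega>))"
      unfolding c by (simp add: mult.commute)
    also have "\<dots> = (\<Sum>i<n + 1. c t i * expectation (\<lambda>\<omega>. N j \<omega> * W i \<omega>))"
      by (rule integral_mult_sum_right[OF Nsq]) (simp add: Wsq)
    also have "\<dots> = 0"
      using expectation_message_noise[OF W N ind] that
      by (intro sum.neutral ballI) (simp add: mult.commute)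
    finally show ?thesis .
  qed
  have Zsq: "square_integrable M (Z t)" for t
    unfolding Z_def[abs_def] by (intro square_integrable_sum square_integrable_cmult Xsq)
  have ZN: "expectation (\<lambda>\<omega>. Z i \<omega> * N j \<omega>) = 0" if "j < T + 1" for i j
  proof -
    have "expectation (\<lambda>\<omega>. Z i \<omega> * N j \<omega>) = expectation (\<lambda>\<omega>. N j \<omega> * (\<Sum>k<T + 1. P $$ (i, k) * X k \<omega>))"
      unfolding Z_def by (simp add: mult.commute)
    also have "\<dots> = (\<Sum>k<T + 1. P $$ (i, k) * expectation (\<lambda>\<omega>. N j \<omega> * X k \<omega>))"
      by (rule integral_mult_sum_right[OF Nsq Xsq])
    also have "\<dots> = 0"
      using XN[OF that] by (intro sum.neutral ballI) (simp add: mult.commute)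
    finally show ?thesis .
  qed
  have Ysq: "square_integrable M (\<lambda>\<omega>. Z t \<omega> + N t \<omega>)" for t
    by (intro square_integrable_add Zsq Nsq)
  have obs_dim: "observation_block num den T n W N A C \<omega> \<in> carrier_vec (T + 1)" for \<omega>
    using P unfolding observation_block_def
    by (intro add_carrier_vec mult_mat_vec_carrier[of _ _ "T + 1"]) (auto simp: source_block_def)
  have obs: "vec_index (observation_block num den T n W N A C \<omega>) t = Z t \<omega> + N t \<omega>" if "t \<le> T" for t \<omega>
    using that P unfolding observation_block_eq[OF P_def[symmetric]]
    by (simp add: index_mult_mat_vec_sum[of _ "T + 1" "T + 1"] Z_def X_def flip: P_def
        del: index_mult_mat_vec)
  show "square_integrable M (\<lambda>\<omega>. vec_index (observation_block num den T n W N A C \<omega>) t)" if "t \<le> T"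
    using Ysq[of t] that by (simp add: obs)
  define J where "J K = expectation (\<lambda>\<omega>. \<Sum>t<T + 1. (X t \<omega> - (\<Sum>j<T + 1. K $$ (t, j) * (Z j \<omega> + N j \<omega>)))\<^sup>2)" for K
  \<comment> \<open>The matrix-vector form agrees with the sum only for matrices of the right size,
    so the equation is restricted to the feasible ones.\<close>
  have est: "estimation_error M num den T n W N A C K = 1 / real (T + 1) * J K"
    if K: "strictly_lower T K" for K
  proof -
    have Kc: "K \<in> carrier_mat (T + 1) (T + 1)"
      using K by (simp add: strictly_lower_def)
    have "source_block T n W A C \<omega> - K *\<^sub>v observation_block num den T n W N A C \<omega> =
        Matrix.vec (T + 1) (\<lambda>t. X t \<omega> - (\<Sum>j<T + 1. K $$ (t, j) * (Z j \<omega> + N j \<omega>)))" for \<omega>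
    proof (rule eq_vecI)
      fix t assume "t < dim_vec (Matrix.vec (T + 1) (\<lambda>t. X t \<omega> - (\<Sum>j<T + 1. K $$ (t, j) * (Z j \<omega> + N j \<omega>))))"
      then have t: "t < T + 1" by simp
      have "vec_index (K *\<^sub>v observation_block num den T n W N A C \<omega>) t =
          (\<Sum>j<T + 1. K $$ (t, j) * (Z j \<omega> + N j \<omega>))"
        unfolding index_mult_mat_vec_sum[OF Kc obs_dim t] by (intro sum.cong refl) (simp add: obs)
      then show "vec_index (source_block T n W A C \<omega> - K *\<^sub>v observation_block num den T n W N A C \<omega>) t =
          vec_index (Matrix.vec (T + 1) (\<lambda>t. X t \<omega> - (\<Sum>j<T + 1. K $$ (t, j) * (Z j \<omega> + N j \<omega>)))) t"
        using t Kc by (simp add: source_block_def X_def del: index_mult_mat_vec)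
    qed (use Kc in \<open>simp add: source_block_def\<close>)
    then show ?thesis
      by (simp add: estimation_error_def J_def scalar_prod_def power2_eq_square atLeast0LessThan
          del: sum.lessThan_Suc)
  qed
  have "\<exists>!K. is_arg_min J (strictly_lower T) K"
    unfolding J_def
  proof (rule ex1_optimal_causal_estimator[OF Xsq Ysq])
    show "(\<Sum>j<T + 1. (k j)\<^sup>2) \<le> expectation (\<lambda>\<omega>. (\<Sum>j<T + 1. k j * (Z j \<omega> + N j \<omega>))\<^sup>2)" for k
      by (intro coercive_signal_plus_noise Zsq Nsq ZN white_gaussian_noise_moments(2)[OF N])
  qed
  \<comment> \<open>The positive factor 1 / (T + 1) does not affect the order, and minimality only
    compares feasible matrices.\<close>
  moreover have "estimation_error M num den T n W N A C K \<le> estimation_error M num den T n W N A C K' \<longleftrightarrow>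
      J K \<le> J K'" if "strictly_lower T K" "strictly_lower T K'" for K K'
    using that by (simp add: est divide_le_cancel)
  then have "is_arg_min (estimation_error M num den T n W N A C) (strictly_lower T) K \<longleftrightarrow>
      is_arg_min J (strictly_lower T) K" for K
    unfolding is_arg_min_linorder by blast
  ultimately show "\<exists>!K. is_arg_min (estimation_error M num den T n W N A C) (strictly_lower T) K"
    by simp
qed

text \<open>Invariance of the rate is expressed by a right-hand side free of \<open>L\<close>: two
  generators are compared through their common open-loop value. The left inverse of the output map
  is given by 1 - P L.\<close>

lemma (in prob_space) information_rate_open_loop:
  assumes W: "standard_gaussian_message M n W" and N: "white_gaussian_noise M N"
    and ind: "indep_var (real_space n) (block n W) (real_space T) (block T N)"
    and A: "A \<in> carrier_mat (n + 1) (n + 1)" and C: "C \<in> carrier_mat 1 (n + 1)"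
    and F: "F \<in> carrier_mat m m" and G: "G \<in> carrier_mat m 1" and H: "H \<in> carrier_mat 1 m"
    and P: "mat_inv (channel_mat T num den) = toeplitz T (markov_parameter F G H 1)"
    and L: "strictly_lower T L"
  shows "information_rate M F G H T n W N A C L =
    1 / real (T + 1) * mutual_information 2 (real_space n) (real_space T) (block n W)
      (block T (\<lambda>t \<omega>. vec_index (observation_block num den T n W N A C \<omega>) t))"
proof -
  let ?obs = "\<lambda>t \<omega>. vec_index (observation_block num den T n W N A C \<omega>) t"
  let ?P = "toeplitz T (markov_parameter F G H 1)"
  define X where "X = 1\<^sub>m (T + 1) - ?P * L"
  define B where "B = mat_inv X"
  have Pc: "?P \<in> carrier_mat (T + 1) (T + 1)"
    by (simp add: toeplitz_def)
  note inv = inverse_one_minus_strictly_lower[OF strictly_lower_mult_left[OF lower_triangular_toeplitz L],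
      of "markov_parameter F G H 1", folded X_def, folded B_def]
  have Bc: "B \<in> carrier_mat (T + 1) (T + 1)"
    using inv(1) by (simp add: lower_triangular_def)
  have Xc: "X \<in> carrier_mat (T + 1) (T + 1)"
    using Pc L unfolding X_def strictly_lower_def by (intro minus_carrier_mat mult_carrier_mat) auto
  have obs_dim: "observation_block num den T n W N A C \<omega> \<in> carrier_vec (T + 1)" for \<omega>
    using Pc P unfolding observation_block_def
    by (intro add_carrier_vec mult_mat_vec_carrier[of _ _ "T + 1"]) (auto simp: source_block_def)
  have out: "output_signal F G H n W N A C L t \<omega> = (\<Sum>j<T + 1. B $$ (t, j) * ?obs j \<omega>)" if "t \<le> T" for t \<omega>
  proof -
    have "output_signal F G H n W N A C L t \<omega> =
        vec_index (Matrix.vec (T + 1) (\<lambda>t. output_signal F G H n W N A C L t \<omega>)) t"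
      using that by simp
    also have "Matrix.vec (T + 1) (\<lambda>t. output_signal F G H n W N A C L t \<omega>) =
        B *\<^sub>v observation_block num den T n W N A C \<omega>"
      unfolding observation_block_eq[OF P] output_signal_def B_def X_def
      by (rule closed_loop(1)[OF F G H L])
    also have "vec_index (B *\<^sub>v observation_block num den T n W N A C \<omega>) t =
        (\<Sum>j<T + 1. B $$ (t, j) * ?obs j \<omega>)"
      using that by (intro index_mult_mat_vec_sum[OF Bc obs_dim]) simp
    finally show ?thesis .
  qed
  have "block T (output_signal F G H n W N A C L) = (\<lambda>\<omega>. linear_map T B (block T ?obs \<omega>))"
    by (auto simp: block_def linear_map_def out fun_eq_iff intro!: sum.cong)
  moreover have "mutual_information 2 (real_space n) (real_space T) (block n W)
      (\<lambda>\<omega>. linear_map T B (block T ?obs \<omega>)) =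
      mutual_information 2 (real_space n) (real_space T) (block n W) (block T ?obs)"
  proof (rule mutual_information_left_inverse)
    show "block n W \<in> measurable M (real_space n)"
      using ind by (rule indep_var_rv1)
    show "block T ?obs \<in> measurable M (real_space T)"
      unfolding block_def[abs_def]
      using square_integrable_observation[OF W N ind A C, of num den] Pc P
      by (intro measurable_restrict) (auto simp: square_integrable_def)
    show "linear_map T X (linear_map T B x) = x" if "x \<in> space (real_space T)" for x
      using that by (rule linear_map_inverse[OF Bc Xc inv(2)])
  qed (rule measurable_linear_map)+
  ultimately show ?thesis
    by (simp add: information_rate_def)
qed

theorem proposition2:
  fixes M :: "'a measure" and W N :: "nat \<Rightarrow> 'a \<Rightarrow> real"
    and num den :: "real poly" and F G H :: "real mat"
    and m n T :: nat and R :: real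
  assumes "prob_space M"
    and "stable_minimum_phase num den"
    and "(transfer_fun num den \<longlongrightarrow> 1) at_infinity"
    and "minimal_realization (\<lambda>z. 1 / transfer_fun num den z) m F G H 1"
    and "stable_mat F" and "1 \<le> m"
    and "white_gaussian_noise M N"
    and "standard_gaussian_message M n W"
    and "prob_space.indep_var M (real_space n) (block n W) (real_space T) (block T N)"
    and "n \<le> T"
  shows "min_power M F G H T n W N R =
      (INF (A, C) \<in> {(A, C). admissible F n A C \<and>
            R \<le> information_rate M F G H T n W N A C (optimal_feedback M F G H T n W N A C)}.
         ereal (average_power M F G H T n W N A C (optimal_feedback M F G H T n W N A C))) \<and>
    (\<forall>A C. admissible F n A C \<longrightarrow>
      (\<exists>!L. is_arg_min (average_power M F G H T n W N A C) (strictly_lower T) L) \<and>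
      (\<exists>!K. is_arg_min (estimation_error M num den T n W N A C) (strictly_lower T) K) \<and>
      optimal_feedback M F G H T n W N A C =
        - optimal_estimator M num den T n W N A C *
          mat_inv (1\<^sub>m (T + 1) -
            mat_inv (channel_mat T num den) * optimal_estimator M num den T n W N A C))"
proof -
  interpret prob_space M by fact
  let ?P = "mat_inv (channel_mat T num den)"
  let ?power = "average_power M F G H T n W N" and ?error = "estimation_error M num den T n W N"
  let ?rate = "information_rate M F G H T n W N"
  let ?fb = "optimal_feedback M F G H T n W N" and ?est = "optimal_estimator M num den T n W N"
  have re: "realization (\<lambda>z. 1 / transfer_fun num den z) m F G H 1"
    using assms(4) by (simp add: minimal_realization_def)
  then have F: "F \<in> carrier_mat m m" and G: "G \<in> carrier_mat m 1" and H: "H \<in> carrier_mat 1 m"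
    by (auto simp: realization_def)
  have P: "?P = toeplitz T (markov_parameter F G H 1)"
    by (rule inverse_channel_mat[OF assms(2,3) re assms(5)])
  then have Pl: "lower_triangular T ?P"
    by (simp add: lower_triangular_toeplitz)
  then have Pc: "?P \<in> carrier_mat (T + 1) (T + 1)"
    by (simp add: lower_triangular_def)
  have est: "\<exists>!K. is_arg_min (?error A C) (strictly_lower T) K"
    and fb: "\<exists>!L. is_arg_min (?power A C) (strictly_lower T) L"
      "?fb A C = feedback_dual T ?P (?est A C)"
    if "admissible F n A C" for A C
  proof -
    show ex1: "\<exists>!K. is_arg_min (?error A C) (strictly_lower T) K"
      using that by (intro ex1_optimal_estimator[OF assms(8,7,9) _ _ Pc]) (auto simp: admissible_def)
    \<comment> \<open>The objectives are the error, whose minimiser is known to be unique, and the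
      power; \<open>feedback_dual\<close> is the involution between them.\<close>
    note ex1_is_arg_min_involution[OF ex1 strictly_lower_feedback_dual[OF Pl] feedback_dual_involution[OF Pl]
        average_power_eq_estimation_error[OF F G H P, where M = M and n = n and W = W and N = N
          and A = A and C = C]]
    then show "\<exists>!L. is_arg_min (?power A C) (strictly_lower T) L"
      "?fb A C = feedback_dual T ?P (?est A C)"
      by (auto simp: optimal_feedback_def optimal_estimator_def)
  qed
  have opt: "strictly_lower T (?fb A C)" "\<And>L. strictly_lower T L \<Longrightarrow> ?power A C (?fb A C) \<le> ?power A C L"
    if "admissible F n A C" for A C
  proof -
    have "is_arg_min (?power A C) (strictly_lower T) (?fb A C)"
      unfolding optimal_feedback_def arg_min_def using fb(1)[OF that] by (metis someI)
    then show "strictly_lower T (?fb A C)" "\<And>L. strictly_lower T L \<Longrightarrow> ?power A C (?fb A C) \<le> ?power A C L"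
      by (auto simp: is_arg_min_linorder)
  qed
  have rate: "?rate A C L = ?rate A C L'"
    if "admissible F n A C" "strictly_lower T L" "strictly_lower T L'" for A C L L'
    using that information_rate_open_loop[OF assms(8,7,9) _ _ F G H P]
    by (simp add: admissible_def)
  have "min_power M F G H T n W N R =
      (INF (A, C) \<in> {(A, C). admissible F n A C \<and> R \<le> ?rate A C (?fb A C)}. ereal (?power A C (?fb A C)))"
    (is "_ = ?inf")
  proof (rule antisym)
    show "min_power M F G H T n W N R \<le> ?inf"
      unfolding min_power_def
    proof (intro INF_greatest, clarify)
      fix A C assume "admissible F n A C" "R \<le> ?rate A C (?fb A C)"
      then show "(INF (A, C, L) \<in> {(A, C, L). admissible F n A C \<and> strictly_lower T L \<and> R \<le> ?rate A C L}.
          ereal (?power A C L)) \<le> ereal (?power A C (?fb A C))"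
        using opt(1) by (intro INF_lower2[of "(A, C, ?fb A C)"]) auto
    qed
    \<comment> \<open>Passing from \<open>L\<close> to the optimal generator keeps the rate
      constraint, by \<open>rate\<close>, and does not raise the power, by
      \<open>opt\<close>.\<close>
    show "?inf \<le> min_power M F G H T n W N R"
      unfolding min_power_def
    proof (intro INF_greatest, clarify)
      fix A C L assume *: "admissible F n A C" "strictly_lower T L" "R \<le> ?rate A C L"
      then have "R \<le> ?rate A C (?fb A C)"
        using rate[OF *(1,2) opt(1)[OF *(1)]] by simp
      then show "?inf \<le> ereal (?power A C L)"
        using * opt(2)[OF *(1,2)] by (intro INF_lower2[of "(A, C)"]) auto
    qed
  qed
  with est fb show ?thesis
    unfolding feedback_dual_def by blast
qed

end
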